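(* The $1/e$-strategy is not optimal over the class $\Theta$ of laws of all p.i.-counting processes; that is, the assertion $$\forall \theta\in\Theta,\ \forall \tau\in\mathcal T:\qquad R(\theta,\tau^* )\ \ge\ R(\theta,\tau)$$ is false. Equivalently, there exist a p.i.-counting process law $P_\theta$ ($\theta\in\Theta$) and a stopping time $\tau\in\mathcal T$ such that $$P_\theta[\rho_\tau=1]\;>\;P_\theta[\rho_{\tau^*}=1].$$
   Context: Counting processes: $(N_t)_{0\le t\le 1}$ is a counting process with $N_0=0$ (right-continuous, integer-valued and finite, non-decreasing, with all jumps equal to $1$); $N_t$ is the number of candidates who have arrived by time $t$, and $N_1\ge 1$ is the total number of candidates. Let $T_1=\inf\{t: N_t=1\}\in(0,1]$ be the first jump time. P.i.-counting process (proportional increments): a counting process $(N_t)_{0\le t\le 1}$ with $N_0=0$ (right-continuous, integer-valued and finite, non-decreasing, with all jumps equal to $1$), with $N_1\ge 1$ and first jump time $T_1=\inf\{t: N_t=1\}\in(0,1]$, such that $$M_t = N_{t\vee T_1}-N_{T_1}-\int_{T_1}^{t\vee T_1}\frac{N_s}{s}\,ds,\qquad t\in(0,1],$$ is a martingale in the natural filtration of the counting process. The law of $T_1$ is otherwise unrestricted. $\{P_\theta:\theta\in\Theta\}$ denotes the collection of laws of all p.i.-counting processes. Ranks: the candidates are uniquely ranked from $1$ (best) to $N_1$ (worst). Given the whole process $(N_t)_{0\le t\le1}$, with $N_1=m$, all $m!$ assignments of the overall ranks $1,\dots,m$ to the successive arrivals are equally likely. The relative rank of the $k$-th arrival is its rank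 among the first $k$ arrivals; an arrival is a record if its relative rank is $1$. Define $\rho_t$ to be the overall rank of the candidate arriving at $t$ if $\Delta N_t=1$, and $\rho_t=0$ otherwise. Strategies: $\mathcal F_t$ is the $\sigma$-algebra generated by $(N_u)_{u\le t}$ together with the relative ranks of all candidates who arrived by time $t$. $\mathcal T$ is the set of all $(\mathcal F_t)$-stopping times with values in $[0,1]$. The value of $\tau\in\mathcal T$ under $\theta\in\Theta$ is $R(\theta,\tau)=P_\theta[\rho_\tau=1]$, the probability that $\tau$ stops at the arrival of the overall best candidate. The $1/e$-strategy is $\tau^*=\inf\{t\ge 1/e:\ \text{a record arrives at time } t\}$, with $\tau^*=1$ if there is no such $t$ (in which case one loses by definition). *)

theory Defs
  imports "HOL-Probability.Probability" "HOL-Combinatorics.Permutations"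
begin

section \<open>Sample space\<close>

text \<open>
  \<open>jump n t\<close> is \<open>n t - n (t-)\<close>. The truncated subtraction on \<^typ>\<open>nat\<close> is harmless since
  \<open>jump\<close> is only used for non-decreasing paths; there is no jump at time 0 since \<open>n 0 = 0\<close>.
\<close>

definition jump :: "(real \<Rightarrow> nat) \<Rightarrow> real \<Rightarrow> nat" where
  "jump n t = (if t > 0 then n t - Lim (at_left t) n else 0)"

definition counting_path :: "(real \<Rightarrow> nat) \<Rightarrow> bool" where
  "counting_path n \<longleftrightarrow>
     n \<in> extensional {0..1} \<and>
     n 0 = 0 \<and>
     mono_on {0..1} n \<and>
     (\<forall>t\<in>{0..<1}. continuous (at_right t) n) \<and>
     (\<forall>t\<in>{0<..1}. jump n t \<in> {0, 1}) \<and>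
     n 1 \<ge> 1"

text \<open>
  An outcome \<open>(n, r)\<close> consists of a counting path \<open>n\<close> and of the ranking \<open>r\<close> of the candidates:
  \<open>r k\<close> is the overall rank of the \<open>k\<close>-th arrival, for \<open>1 \<le> k \<le> n 1\<close>. Laws live on this
  canonical space, so that stopping rules do not depend on the law.
\<close>

type_synonym outcome = "(real \<Rightarrow> nat) \<times> (nat \<Rightarrow> nat)"

definition Omega :: "outcome set" where
  "Omega = {(n, r). counting_path n \<and> r permutes {1..n 1}}"

definition outcome_algebra :: "outcome measure" where
  "outcome_algebra = sigma Omega
     ({{(n, r) \<in> Omega. n u = k} | u k. u \<in> {0..1}} \<union> {{(n, r) \<in> Omega. r k = j} | k j. True})"

definition first_arrival :: "(real \<Rightarrow> nat) \<Rightarrow> real" where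
  "first_arrival n = Inf {t \<in> {0..1}. n t = 1}"

definition rel_rank :: "(nat \<Rightarrow> nat) \<Rightarrow> nat \<Rightarrow> nat" where
  "rel_rank r k = card {j \<in> {1..k}. r j \<le> r k}"

definition rho :: "real \<Rightarrow> outcome \<Rightarrow> nat" where
  "rho t = (\<lambda>(n, r). if jump n t = 1 then r (n t) else 0)"

definition record_at :: "real \<Rightarrow> outcome \<Rightarrow> bool" where
  "record_at t = (\<lambda>(n, r). jump n t = 1 \<and> rel_rank r (n t) = 1)"


section \<open>Laws of p.i.-counting processes\<close>

text \<open>The natural filtration of the counting process alone.\<close>

definition counting_filtration :: "real \<Rightarrow> outcome measure" where
  "counting_filtration t =
     sigma Omega {{(n, r) \<in> Omega. n u = k} | u k. u \<in> {0..1} \<and> u \<le> t}"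

definition is_martingale ::
  "'a measure \<Rightarrow> 't::linorder set \<Rightarrow> ('t \<Rightarrow> 'a measure) \<Rightarrow> ('t \<Rightarrow> 'a \<Rightarrow> real) \<Rightarrow> bool" where
  "is_martingale P I F X \<longleftrightarrow>
     (\<forall>t\<in>I. subalgebra P (F t) \<and> X t \<in> borel_measurable (F t) \<and> integrable P (X t)) \<and>
     (\<forall>s\<in>I. \<forall>t\<in>I. s \<le> t \<longrightarrow> (AE \<omega> in P. real_cond_exp P (F s) (X t) \<omega> = X s \<omega>))"

definition compensated :: "real \<Rightarrow> outcome \<Rightarrow> real" where
  "compensated t = (\<lambda>(n, r). let T1 = first_arrival n in
     real (n (max t T1)) - real (n T1) - integral {T1..max t T1} (\<lambda>s. real (n s) / s))"

text \<open>Given the whole counting process with \<open>n 1 = m\<close>, all \<open>m!\<close> rankings are equally likely.\<close>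

definition uniform_ranks :: "outcome measure \<Rightarrow> bool" where
  "uniform_ranks P \<longleftrightarrow>
     (\<forall>E \<in> sets (counting_filtration 1). \<forall>m p. p permutes {1..m} \<longrightarrow>
        measure P (E \<inter> {(n, r) \<in> Omega. n 1 = m \<and> r = p}) =
        measure P (E \<inter> {(n, r) \<in> Omega. n 1 = m}) / fact m)"

definition pi_laws :: "outcome measure set" where
  "pi_laws = {P. prob_space P \<and> space P = Omega \<and> sets P = sets outcome_algebra \<and>
     uniform_ranks P \<and> is_martingale P {0<..1} counting_filtration compensated}"


section \<open>Strategies\<close>

text \<open>
  By time \<open>t\<close> one has observed the counting process up to \<open>t\<close> and the relative rank of each
  \<open>k\<close>-th arrival with \<open>k \<le> n u\<close> for some \<open>u \<le> t\<close>; before its arrival this rank is replaced by 0.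
\<close>

definition info_filtration :: "real \<Rightarrow> outcome measure" where
  "info_filtration t = sigma Omega
     ({{(n, r) \<in> Omega. n u = k} | u k. u \<in> {0..1} \<and> u \<le> t} \<union>
      {{(n, r) \<in> Omega. (if k \<le> n u then rel_rank r k else 0) = j} | u k j.
         u \<in> {0..1} \<and> u \<le> t \<and> 1 \<le> k})"

definition strategies :: "(outcome \<Rightarrow> real) set" where
  "strategies = {\<tau>. stopping_time info_filtration \<tau> \<and> (\<forall>\<omega>\<in>Omega. \<tau> \<omega> \<in> {0..1})}"

definition win_prob :: "outcome measure \<Rightarrow> (outcome \<Rightarrow> real) \<Rightarrow> real" where
  "win_prob P \<tau> = measure P {\<omega> \<in> Omega. rho (\<tau> \<omega>) \<omega> = 1}"

text \<open>
  If no record arrives in \<open>[1/e, 1]\<close>, then in particular no overall best candidate arrives at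
  time 1, so that stopping at time 1 loses, as it should by convention.
\<close>

definition tau_star :: "outcome \<Rightarrow> real" where
  "tau_star \<omega> = (let S = {t \<in> {1 / exp 1..1}. record_at t \<omega>} in if S = {} then 1 else Inf S)"

end

theory Submission
  imports Defs
begin

text \<open>
  Let the first candidate arrive at a deterministic time \<open>a\<close> slightly below \<open>1 / e\<close>. The number of
  later arrivals is then geometric with parameter \<open>a\<close>, and given this number their times are
  i.i.d. uniform on \<open>(a, 1]\<close>. The first candidate is the best one with probability
  \<open>E(1 / N\<^sub>1)\<close>, which exceeds 1/2 for \<open>a = 9 / 25\<close>. Hence stopping at time \<open>a\<close> wins with
  probability above 1/2, while the \<open>1 / e\<close>-strategy always passes over the first candidate.

  For the martingale property, let \<open>A\<close> be an event in the past of \<open>s \<ge> a\<close>. Since \<open>A\<close> is insensitive to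
  arrivals after \<open>s\<close>, removing one such arrival and shifting the geometric weights gives
  \<open>E((N\<^sub>1 - N\<^sub>s) 1\<^sub>A) = (1 - s) E(N\<^sub>1 1\<^sub>A)\<close>. So \<open>E(N\<^sub>t 1\<^sub>A) = t E(N\<^sub>1 1\<^sub>A)\<close> for all \<open>t \<ge> s\<close>, and by Fubini the
  increments of \<open>N\<close> and of the compensator agree in expectation on \<open>A\<close>.
\<close>

section \<open>Counting paths\<close>

text \<open>In the discrete space \<open>nat\<close> convergence means being eventually constant, so
  the left limit is the constant value on a left neighbourhood.\<close>

lemma Lim_at_left_eqI:
  fixes f :: "real \<Rightarrow> nat"
  assumes "d < t" and "\<And>u. d < u \<Longrightarrow> u < t \<Longrightarrow> f u = k"
  shows "Lim (at_left t) f = k"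
proof (rule tendsto_Lim)
  show "(f \<longlongrightarrow> k) (at_left t)"
    unfolding tendsto_discrete eventually_at_left_field using assms by blast
qed simp

lemma counting_path_monoD:
  assumes "counting_path n" "0 \<le> s" "s \<le> t" "t \<le> 1"
  shows "n s \<le> n t"
  using assms by (auto simp: counting_path_def mono_on_def)

lemma counting_path_right_continuous:
  assumes "counting_path n" "0 \<le> t" "t < 1"
  shows "\<exists>y>t. \<forall>u. t < u \<longrightarrow> u < y \<longrightarrow> n u = n t"
proof -
  have "continuous (at_right t) n"
    using assms by (auto simp: counting_path_def)
  then show ?thesis
    by (simp add: continuous_within tendsto_discrete eventually_at_right_field)
qed

text \<open>Only finitely many values occur on \<open>{0..<t}\<close>. From a point \<open>d\<close>
  where the largest of them is attained, monotonicity keeps the path constant up to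
  \<open>t\<close>. So the \<open>Lim\<close> inside \<open>jump\<close> is a genuine left
  limit.\<close>

lemma counting_path_left_limit:
  assumes "counting_path n" "0 < t" "t \<le> 1"
  obtains d where "0 \<le> d" "d < t" "\<And>u. d \<le> u \<Longrightarrow> u < t \<Longrightarrow> n u = Lim (at_left t) n"
proof -
  have fin: "finite (n ` {0..<t})"
  proof (rule finite_subset)
    show "n ` {0..<t} \<subseteq> {..n 1}"
      using assms counting_path_monoD[OF assms(1)] by auto
  qed simp
  moreover have "n ` {0..<t} \<noteq> {}"
    using assms by auto
  ultimately have "Max (n ` {0..<t}) \<in> n ` {0..<t}"
    by (rule Max_in)
  then obtain d where d: "0 \<le> d" "d < t" "n d = Max (n ` {0..<t})"
    by auto
  have const: "n u = n d" if "d \<le> u" "u < t" for u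
  proof (rule antisym)
    show "n u \<le> n d"
      using d that fin by (auto intro!: Max_ge)
    show "n d \<le> n u"
      using that assms(3) by (intro counting_path_monoD[OF assms(1) d(1)]) auto
  qed
  have "Lim (at_left t) n = n d"
    by (rule Lim_at_left_eqI[OF d(2)]) (rule const, simp_all)
  with const d(1,2) show thesis
    by (metis that)
qed

lemma counting_path_jump_greater:
  assumes "counting_path n" "0 \<le> s" "s < t" "t \<le> 1" "jump n t = 1"
  shows "n s < n t"
proof -
  obtain d where d: "0 \<le> d" "d < t" "\<And>u. d \<le> u \<Longrightarrow> u < t \<Longrightarrow> n u = Lim (at_left t) n"
    using counting_path_left_limit[of n t] assms by auto
  \<comment> \<open>The time \<open>max d s\<close> is not before \<open>s\<close> and lies in the
    stretch where the path already equals its left limit at \<open>t\<close>.\<close>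
  have "n s \<le> n (max d s)"
    using assms(2-4) d(1,2) by (intro counting_path_monoD[OF assms(1,2)]) auto
  also have "\<dots> = Lim (at_left t) n"
    using d assms by auto
  also have "\<dots> < n t"
    using assms(2,3,5) by (simp add: jump_def)
  finally show ?thesis .
qed

text \<open>The definition takes the infimum over \<open>n t = 1\<close>, a set not yet known to be
  nonempty. The argument runs with the infimum \<open>T\<close> of the times with
  \<open>1 \<le> n t\<close>: right continuity shows that it is attained, and since the path
  vanishes before \<open>T\<close>, the unit jump bound forces \<open>n T = 1\<close>.\<close>

lemma first_arrival_props:
  assumes "counting_path n"
  shows "0 < first_arrival n" "first_arrival n \<le> 1" "n (first_arrival n) = 1"
    "\<And>u. 0 \<le> u \<Longrightarrow> u < first_arrival n \<Longrightarrow> n u = 0"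
    "\<And>u. first_arrival n \<le> u \<Longrightarrow> u \<le> 1 \<Longrightarrow> 1 \<le> n u"
proof -
  define S where "S = {t \<in> {0..1}. 1 \<le> n t}"
  define T where "T = Inf S"
  have "1 \<in> S"
    using assms by (auto simp: S_def counting_path_def)
  have bdd: "bdd_below S"
    by (auto simp: S_def bdd_below_def)
  have T: "0 \<le> T" "T \<le> 1"
    unfolding T_def using \<open>1 \<in> S\<close> bdd
    by (auto intro!: cInf_greatest cInf_lower simp: S_def)
  have zero: "n u = 0" if "0 \<le> u" "u < T" for u
  proof (rule ccontr)
    assume "n u \<noteq> 0"
    then have "u \<in> S"
      using that T by (auto simp: S_def)
    then have "T \<le> u"
      unfolding T_def using bdd by (rule cInf_lower)
    with that show False by simp
  qed
  have "1 \<le> n T"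
  proof (cases "T = 1")
    case True
    then show ?thesis using \<open>1 \<in> S\<close> by (auto simp: S_def)
  next
    case False
    then obtain y where y: "y > T" "\<And>u. T < u \<Longrightarrow> u < y \<Longrightarrow> n u = n T"
      using counting_path_right_continuous[OF assms, of T] T by auto
    then obtain x where x: "x \<in> S" "x < y"
      using cInf_lessD[of S y] \<open>1 \<in> S\<close> by (auto simp: T_def)
    have "T \<le> x"
      unfolding T_def using x bdd by (auto intro: cInf_lower)
    then have "n x = n T"
      using x y by (cases "T = x") auto
    then show ?thesis using x by (auto simp: S_def)
  qed
  moreover have "n 0 = 0"
    using assms by (simp add: counting_path_def)
  ultimately have "0 < T"
    using T by (cases "T = 0") auto
  then have "Lim (at_left T) n = 0"
    using zero by (intro Lim_at_left_eqI[of 0]) auto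
  then have "jump n T = n T"
    using \<open>0 < T\<close> by (simp add: jump_def)
  moreover have "jump n T \<in> {0, 1}"
    using assms \<open>0 < T\<close> T by (auto simp: counting_path_def)
  ultimately have one: "n T = 1"
    using \<open>1 \<le> n T\<close> by auto
  have "first_arrival n = T"
    unfolding first_arrival_def
  proof (rule cInf_eq_minimum)
    show "T \<in> {t \<in> {0..1}. n t = 1}"
      using one T by auto
  next
    fix x assume "x \<in> {t \<in> {0..1}. n t = 1}"
    then show "T \<le> x"
      using zero[of x] by (cases "x < T") auto
  qed
  then show "0 < first_arrival n" "first_arrival n \<le> 1" "n (first_arrival n) = 1"
    "\<And>u. 0 \<le> u \<Longrightarrow> u < first_arrival n \<Longrightarrow> n u = 0"
    "\<And>u. first_arrival n \<le> u \<Longrightarrow> u \<le> 1 \<Longrightarrow> 1 \<le> n u"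
    using \<open>0 < T\<close> T(2) one zero counting_path_monoD[OF assms T(1)] by simp_all
qed

section \<open>Counting paths with a prescribed finite set of arrival times\<close>

text \<open>The restriction to \<open>{0..1}\<close> is there because counting paths are extensional
  on the unit interval.\<close>

definition arrival_path :: "real set \<Rightarrow> real \<Rightarrow> nat" where
  "arrival_path F = (\<lambda>t\<in>{0..1}. card (F \<inter> {..t}))"

lemma jump_arrival_path:
  assumes "finite F" "0 < t" "t \<le> 1"
  shows "jump (arrival_path F) t = (if t \<in> F then 1 else 0)"
proof -
  \<comment> \<open>The last arrival before \<open>t\<close>; inserting 0 covers the case that there
    is none.\<close>
  define d where "d = Max (insert 0 (F \<inter> {..<t}))"
  have d: "0 \<le> d" "d < t"
    unfolding d_def using assms by auto
  have "Lim (at_left t) (arrival_path F) = card (F \<inter> {..<t})"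
  proof (rule Lim_at_left_eqI[OF d(2)])
    fix u assume u: "d < u" "u < t"
    have "x \<le> d" if "x \<in> F" "x < t" for x
      unfolding d_def using that assms by (intro Max_ge) auto
    then have "F \<inter> {..u} = F \<inter> {..<t}"
      using u by force
    then show "arrival_path F u = card (F \<inter> {..<t})"
      using u d assms by (simp add: arrival_path_def)
  qed
  moreover have "card (F \<inter> {..t}) = card (F \<inter> {..<t}) + (if t \<in> F then 1 else 0)"
  proof (cases "t \<in> F")
    case True
    then have "F \<inter> {..t} = insert t (F \<inter> {..<t})" by auto
    then show ?thesis using True assms by simp
  next
    case False
    have "x \<in> F \<inter> {..t} \<longleftrightarrow> x \<in> F \<inter> {..<t}" for x
      using False by (cases "x = t") auto
    then have "F \<inter> {..t} = F \<inter> {..<t}" by blast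
    then show ?thesis using False by simp
  qed
  ultimately show ?thesis
    using assms by (simp add: jump_def arrival_path_def)
qed

lemma counting_path_arrival_path:
  assumes "finite F" "F \<noteq> {}" "F \<subseteq> {0<..1}"
  shows "counting_path (arrival_path F)"
  unfolding counting_path_def
proof (intro conjI ballI)
  show "arrival_path F \<in> extensional {0..1}"
    by (simp add: arrival_path_def)
  have "F \<inter> {..0} = {}" "F \<inter> {..1} = F"
    using assms by auto
  then show "arrival_path F 0 = 0" "1 \<le> arrival_path F 1"
    using assms by (auto simp: arrival_path_def Suc_le_eq card_gt_0_iff)
  show "mono_on {0..1} (arrival_path F)"
    using assms by (auto simp: mono_on_def arrival_path_def intro!: card_mono)
next
  fix t :: real assume t: "t \<in> {0..<1}"
  \<comment> \<open>The next arrival after \<open>t\<close>, or 1 if there is none.\<close>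
  define y where "y = Min (insert 1 (F \<inter> {t<..}))"
  have y: "t < y" "y \<le> 1"
    unfolding y_def using t assms by auto
  have "arrival_path F u = arrival_path F t" if u: "t < u" "u < y" for u
  proof -
    have "y \<le> x" if "x \<in> F" "t < x" for x
      unfolding y_def using that assms by (intro Min_le) auto
    then have "F \<inter> {..u} = F \<inter> {..t}"
      using u by force
    then show ?thesis
      using u t y by (simp add: arrival_path_def)
  qed
  then show "continuous (at_right t) (arrival_path F)"
    unfolding continuous_within tendsto_discrete eventually_at_right_field
    using y by blast
next
  fix t :: real assume "t \<in> {0<..1}"
  then show "jump (arrival_path F) t \<in> {0, 1}"
    using assms by (simp add: jump_arrival_path)
qed

lemma arrival_path_1: "F \<subseteq> {0<..1} \<Longrightarrow> arrival_path F 1 = card F"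
  by (simp add: arrival_path_def) (metis Int_absorb2 atMost_iff greaterThanAtMost_iff subset_iff)

section \<open>The filtration of the counting process\<close>

lemma space_counting_filtration [simp]: "space (counting_filtration t) = Omega"
  by (auto simp: counting_filtration_def intro!: space_measure_of)

lemma space_outcome_algebra [simp]: "space outcome_algebra = Omega"
  by (auto simp: outcome_algebra_def intro!: space_measure_of)

lemma sets_counting_filtration:
  "sets (counting_filtration t) =
     sigma_sets Omega {{(n, r) \<in> Omega. n u = k} | u k. u \<in> {0..1} \<and> u \<le> t}"
  unfolding counting_filtration_def by (rule sets_measure_of) auto

lemma sets_outcome_algebra:
  "sets outcome_algebra = sigma_sets Omega
     ({{(n, r) \<in> Omega. n u = k} | u k. u \<in> {0..1}} \<union> {{(n, r) \<in> Omega. r k = j} | k j. True})"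
  unfolding outcome_algebra_def by (rule sets_measure_of) auto

lemma sets_counting_filtration_mono:
  "s \<le> t \<Longrightarrow> sets (counting_filtration s) \<subseteq> sets (counting_filtration t)"
  unfolding sets_counting_filtration by (rule sigma_sets_mono') fastforce

lemma sets_counting_filtration_outcome_algebra:
  "sets (counting_filtration t) \<subseteq> sets outcome_algebra"
  unfolding sets_counting_filtration sets_outcome_algebra by (rule sigma_sets_mono') fastforce

text \<open>Each generator depends only on the path up to \<open>t\<close>, and this survives
  complements and countable unions. It is the source of two facts used later: events of this
  filtration ignore the ranks, and they ignore arrivals after \<open>t\<close>.\<close>

lemma counting_filtration_determined:
  assumes "A \<in> sets (counting_filtration t)"
    and "(n, r) \<in> Omega" "(n', r') \<in> Omega"
    and "\<And>u. 0 \<le> u \<Longrightarrow> u \<le> 1 \<Longrightarrow> u \<le> t \<Longrightarrow> n u = n' u"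
  shows "(n, r) \<in> A \<longleftrightarrow> (n', r') \<in> A"
  using assms(1) unfolding sets_counting_filtration
proof (induction rule: sigma_sets.induct)
  case (Basic A)
  then show ?case using assms(2-) by auto
qed (use assms(2-) in auto)

lemma measurable_count_counting_filtration:
  assumes "u \<in> {0..1}" "u \<le> t"
  shows "(\<lambda>\<omega>. fst \<omega> u) \<in> counting_filtration t \<rightarrow>\<^sub>M count_space UNIV"
proof (rule measurable_count_space_eq2_countable[THEN iffD2], simp_all, safe)
  fix k
  have "(\<lambda>\<omega>. fst \<omega> u) -` {k} \<inter> Omega = {(n, r) \<in> Omega. n u = k}"
    by auto
  also have "\<dots> \<in> sets (counting_filtration t)"
    unfolding sets_counting_filtration using assms by (intro sigma_sets.Basic) auto
  finally show "(\<lambda>\<omega>. fst \<omega> u) -` {k} \<inter> Omega \<in> sets (counting_filtration t)" .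
qed

lemma measurable_count_outcome_algebra [measurable (raw)]:
  assumes "u \<in> {0..1}"
  shows "(\<lambda>\<omega>. fst \<omega> u) \<in> outcome_algebra \<rightarrow>\<^sub>M count_space UNIV"
proof -
  have "measurable (counting_filtration u) (count_space UNIV)
      \<subseteq> measurable outcome_algebra (count_space (UNIV :: nat set))"
    using sets_counting_filtration_outcome_algebra by (intro measurable_mono) auto
  then show ?thesis
    using measurable_count_counting_filtration[OF assms order_refl] by blast
qed

lemma measurable_rank_outcome_algebra:
  "(\<lambda>\<omega>. snd \<omega> k) \<in> outcome_algebra \<rightarrow>\<^sub>M count_space UNIV"
proof (rule measurable_count_space_eq2_countable[THEN iffD2], simp_all, safe)
  fix j
  have "(\<lambda>\<omega>. snd \<omega> k) -` {j} \<inter> Omega = {(n, r) \<in> Omega. r k = j}"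
    by auto
  also have "\<dots> \<in> sets outcome_algebra"
    unfolding sets_outcome_algebra by (intro sigma_sets.Basic) auto
  finally show "(\<lambda>\<omega>. snd \<omega> k) -` {j} \<inter> Omega \<in> sets outcome_algebra" .
qed

lemma subalgebra_counting_filtration:
  "sets P = sets outcome_algebra \<Longrightarrow> subalgebra P (counting_filtration t)"
  using sets_counting_filtration_outcome_algebra[of t] sets_eq_imp_space_eq[of P outcome_algebra]
  by (simp add: subalgebra_def)

section \<open>Joint measurability and the compensator\<close>

text \<open>The fraction is the first point of the grid of mesh \<open>1 / Suc m\<close> strictly to
  the right of \<open>u\<close>, so right continuity makes the values eventually equal to
  \<open>n u\<close>. Clipping to the interval from 0 to \<open>t\<close> means that only the path
  up to time \<open>t\<close> is consulted.\<close>

lemma counting_path_approx_right: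
  fixes u t :: real
  assumes "counting_path n" "0 \<le> u" "u < t" "t \<le> 1"
  shows "(\<lambda>m. real (n (max 0 (min t (real_of_int (\<lfloor>u * real (Suc m)\<rfloor> + 1) / Suc m))))) \<longlonglongrightarrow> n u"
proof -
  define q where "q m = real_of_int (\<lfloor>u * real (Suc m)\<rfloor> + 1) / Suc m" for m
  have q: "u < q m" "q m \<le> u + 1 / Suc m" for m
  proof -
    have "u * real (Suc m) < real_of_int (\<lfloor>u * real (Suc m)\<rfloor> + 1)" "real_of_int (\<lfloor>u * real (Suc m)\<rfloor> + 1) \<le> u * real (Suc m) + 1"
      by linarith+
    then have "u * real (Suc m) / real (Suc m) < q m" "q m \<le> (u * real (Suc m) + 1) / real (Suc m)"
      unfolding q_def by (intro divide_strict_right_mono divide_right_mono; simp)+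
    then show "u < q m" "q m \<le> u + 1 / Suc m"
      by (simp_all add: add_divide_distrib del: of_nat_Suc)
  qed
  obtain y where y: "u < y" "\<And>v. u < v \<Longrightarrow> v < y \<Longrightarrow> n v = n u"
    using counting_path_right_continuous[of n u] assms by auto
  have "(\<lambda>m. u + 1 / Suc m) \<longlonglongrightarrow> u + 0"
    by (intro tendsto_intros LIMSEQ_Suc lim_1_over_n)
  then have "\<forall>\<^sub>F m in sequentially. u + 1 / Suc m < y"
    using y(1) by (intro order_tendstoD) auto
  then have "\<forall>\<^sub>F m in sequentially. real (n (max 0 (min t (q m)))) = real (n u)"
  proof eventually_elim
    case (elim m)
    have "u < max 0 (min t (q m))" "max 0 (min t (q m)) < y"
      using elim q[of m] assms by auto
    then show ?case using y(2) by simp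
  qed
  then show ?thesis
    unfolding q_def by (intro tendsto_eventually) 
qed

text \<open>Progressive measurability by discretisation: each \<open>f m\<close> evaluates the path
  at one of countably many times \<open>q m i\<close>, selected by the integer part of
  \<open>u * Suc m\<close>. Since all these times are at most \<open>t\<close>, the approximations
  are measurable for \<open>counting_filtration t\<close>.\<close>

lemma measurable_counting_path_joint:
  assumes t: "0 \<le> t" "t \<le> 1"
  shows "(\<lambda>(\<omega>, u). real (fst \<omega> u) * indicator {0<..<t} u)
    \<in> borel_measurable (counting_filtration t \<Otimes>\<^sub>M lborel)"
proof (rule borel_measurable_LIMSEQ_real)
  define q where "q m (i :: int) = max 0 (min t (real_of_int (i + 1) / Suc m))" for m i
  define f where "f m = (\<lambda>(\<omega> :: outcome, u :: real). real (fst \<omega> (q m \<lfloor>u * real (Suc m)\<rfloor>)) * indicator {0<..<t} u)" for m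
  show "(\<lambda>m. f m x) \<longlonglongrightarrow> (case x of (\<omega>, u) \<Rightarrow> real (fst \<omega> u) * indicator {0<..<t} u)"
    if "x \<in> space (counting_filtration t \<Otimes>\<^sub>M lborel)" for x
  proof -
    obtain n r u where x: "x = ((n, r), u)" by (metis prod.exhaust)
    then have "counting_path n"
      using that by (auto simp: space_pair_measure Omega_def)
    show ?thesis
    proof (cases "u \<in> {0<..<t}")
      case True
      then show ?thesis
        using counting_path_approx_right[OF \<open>counting_path n\<close>, of u t] t by (simp add: x f_def q_def)
    qed (simp add: x f_def)
  qed
  have "q m i \<in> {0..1}" "q m i \<le> t" for m i
    using t by (auto simp: q_def)
  then have [measurable]: "(\<lambda>\<omega>. fst \<omega> (q m i)) \<in> counting_filtration t \<rightarrow>\<^sub>M count_space UNIV" for m i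
    by (rule measurable_count_counting_filtration)
  have "(\<lambda>x. (\<lambda>i x. real (fst (fst x) (q m i)) * indicator {0<..<t} (snd x)) \<lfloor>snd x * real (Suc m)\<rfloor> x)
    \<in> borel_measurable (counting_filtration t \<Otimes>\<^sub>M lborel)" for m
    by (rule measurable_compose_countable) measurable
  then show "f m \<in> borel_measurable (counting_filtration t \<Otimes>\<^sub>M lborel)" for m
    unfolding f_def by (simp add: case_prod_beta')
qed

lemma measurable_counting_path:
  assumes "counting_path n"
  shows "(\<lambda>u. real (n u) * indicator {0<..<1} u) \<in> borel_measurable lborel"
proof -
  have "(n, id) \<in> space (counting_filtration 1)"
    using assms by (simp add: Omega_def permutes_id)
  from measurable_Pair2[OF measurable_counting_path_joint[of 1] this] show ?thesis
    by simp
qed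

text \<open>Since \<open>s > 0\<close>, the integrand is bounded by \<open>n 1 / s\<close>. The
  gauge integral in \<open>compensated\<close> is therefore a Lebesgue integral, to which Fubini
  applies; the open interval fits the joint measurability lemma.\<close>

lemma counting_path_integral:
  assumes n: "counting_path n" and st: "0 < s" "s \<le> t" "t \<le> 1"
  shows "integrable lborel (\<lambda>u. real (n u) / u * indicator {s<..<t} u)"
    and "integral {s..t} (\<lambda>u. real (n u) / u) = (LBINT u. real (n u) / u * indicator {s<..<t} u)"
    and "(\<lambda>u. real (n u) / u) integrable_on {s..t}"
proof -
  have "(\<lambda>u. real (n u) * indicator {0<..<1} u * (indicator {s<..<t} u / u)) \<in> borel_measurable lborel"
    using measurable_counting_path[OF n] by measurable
  also have "(\<lambda>u. real (n u) * indicator {0<..<1} u * (indicator {s<..<t} u / u))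
     = (\<lambda>u. real (n u) / u * indicator {s<..<t} u)"
    using st by (auto simp: fun_eq_iff indicator_def)
  finally have meas: "(\<lambda>u. real (n u) / u * indicator {s<..<t} u) \<in> borel_measurable lborel" .
  show *: "integrable lborel (\<lambda>u. real (n u) / u * indicator {s<..<t} u)"
  proof (rule Bochner_Integration.integrable_bound[OF _ meas])
    show "integrable lborel (\<lambda>u. real (n 1) / s * indicator {s<..<t} u)"
      by (intro integrable_mult_right integrable_real_indicator) (use st in auto)
    show "AE u in lborel. norm (real (n u) / u * indicator {s<..<t} u)
        \<le> norm (real (n 1) / s * indicator {s<..<t} u)"
      using st counting_path_monoD[OF n, of _ 1]
      by (auto simp: indicator_def intro!: frac_le)
  qed
  then have **: "set_integrable lborel {s<..<t} (\<lambda>u. real (n u) / u)"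
    by (simp add: set_integrable_def mult.commute)
  show "integral {s..t} (\<lambda>u. real (n u) / u) = (LBINT u. real (n u) / u * indicator {s<..<t} u)"
    using set_borel_integral_eq_integral(2)[OF **]
    by (simp add: integral_open_interval_real set_lebesgue_integral_def mult.commute)
  show "(\<lambda>u. real (n u) / u) integrable_on {s..t}"
    using set_borel_integral_eq_integral(1)[OF **] by (simp add: integrable_on_open_interval_real)
qed

text \<open>This form eliminates the random time \<open>first_arrival\<close>. The path vanishes
  before it, so the integral may start at 0, and \<open>min 1\<close> of the count subtracts the
  first arrival exactly when it has occurred. Only values up to \<open>t\<close> remain, which
  yields adaptedness.\<close>

lemma compensated_eq:
  assumes \<omega>: "\<omega> \<in> Omega" and t: "0 < t" "t \<le> 1"
  shows "compensated t \<omega> = real (fst \<omega> t) - min 1 (real (fst \<omega> t))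
    - (LBINT u. real (fst \<omega> u) / u * indicator {0<..<t} u)"
proof -
  obtain n r where [simp]: "\<omega> = (n, r)" and n: "counting_path n"
    using \<omega> by (auto simp: Omega_def)
  note T = first_arrival_props[OF n]
  define T where "T = first_arrival n"
  show ?thesis
  proof (cases "T \<le> t")
    case False
    then have "(\<lambda>u. real (n u) / u * indicator {0<..<t} u) = (\<lambda>u. 0)" "n t = 0"
      using T(4) t by (auto simp: T_def fun_eq_iff indicator_def)
    then show ?thesis
      using False by (simp add: compensated_def T_def[symmetric])
  next
    case True
    \<comment> \<open>At \<open>u = T\<close> itself the two integrands may differ, but a single
      point is a null set.\<close>
    have eq: "real (n u) / u * indicator {0<..<t} u = real (n u) / u * indicator {T<..<t} u"
      if "u \<noteq> T" for u
      using T(1) T(4)[of u] that by (cases "u < T") (auto simp: T_def[symmetric] indicator_def)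
    then have "(LBINT u. real (n u) / u * indicator {0<..<t} u)
        = (LBINT u. real (n u) / u * indicator {T<..<t} u)"
    proof (intro integral_cong_AE)
      have "(\<lambda>u. real (n u) * indicator {0<..<1} u * (indicator {0<..<t} u / u)) \<in> borel_measurable lborel"
        using measurable_counting_path[OF n] by measurable
      also have "(\<lambda>u. real (n u) * indicator {0<..<1} u * (indicator {0<..<t} u / u))
         = (\<lambda>u. real (n u) / u * indicator {0<..<t} u)"
        using t by (auto simp: fun_eq_iff indicator_def)
      finally show "(\<lambda>u. real (n u) / u * indicator {0<..<t} u) \<in> borel_measurable lborel" .
      show "(\<lambda>u. real (n u) / u * indicator {T<..<t} u) \<in> borel_measurable lborel"
        using counting_path_integral(1)[OF n, of T t] T True t by (simp add: T_def[symmetric])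
      show "AE u in lborel. real (n u) / u * indicator {0<..<t} u = real (n u) / u * indicator {T<..<t} u"
        using AE_lborel_singleton[of T] by eventually_elim (rule eq)
    qed
    also have "\<dots> = integral {T..t} (\<lambda>u. real (n u) / u)"
      using counting_path_integral(2)[OF n, of T t] T True t by (simp add: T_def[symmetric])
    finally show ?thesis
      using True T(3) T(5)[of t] t by (simp add: compensated_def T_def[symmetric] Let_def max_def)
  qed
qed

lemma measurable_compensated:
  assumes t: "0 < t" "t \<le> 1"
  shows "compensated t \<in> borel_measurable (counting_filtration t)"
proof -
  have [measurable]: "(\<lambda>\<omega>. fst \<omega> t) \<in> counting_filtration t \<rightarrow>\<^sub>M count_space UNIV"
    using t by (intro measurable_count_counting_filtration) auto
  have "(\<lambda>(\<omega>, u). real (fst \<omega> u) * indicator {0<..<t} u)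
    \<in> borel_measurable (counting_filtration t \<Otimes>\<^sub>M lborel)"
    using t by (intro measurable_counting_path_joint) auto
  then have "(\<lambda>x. (case x of (\<omega>, u) \<Rightarrow> real (fst \<omega> u) * indicator {0<..<t} u) / snd x)
    \<in> borel_measurable (counting_filtration t \<Otimes>\<^sub>M lborel)"
    by measurable
  then have [measurable]: "(\<lambda>(\<omega>, u). real (fst \<omega> u) / u * indicator {0<..<t} u)
    \<in> borel_measurable (counting_filtration t \<Otimes>\<^sub>M lborel)"
    by (simp add: case_prod_beta')
  have "(\<lambda>\<omega>. real (fst \<omega> t) - min 1 (real (fst \<omega> t))
    - (LBINT u. real (fst \<omega> u) / u * indicator {0<..<t} u)) \<in> borel_measurable (counting_filtration t)"
    by measurable
  then show ?thesis
    using t by (subst measurable_cong[OF compensated_eq]) auto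
qed

lemma set_pmf_permutations:
  "set_pmf (pmf_of_set {p. p permutes {1..m :: nat}}) = {p. p permutes {1..m}}"
proof (rule set_pmf_of_set)
  show "{p. p permutes {1..m}} \<noteq> {}"
    using permutes_id by blast
qed (simp add: finite_permutations)

section \<open>The law with deterministic first arrival\<close>

locale fixed_first_arrival =
  fixes a :: real
  assumes a_pos: "0 < a" and a_less_1: "a < 1"
begin

section \<open>I.i.d. later arrival times and the arrival set\<close>

definition later_arrival :: "real measure" where
  "later_arrival = uniform_measure lborel {a..1}"

sublocale later: prob_space later_arrival
  unfolding later_arrival_def using a_less_1 by (intro prob_space_uniform_measure) auto

sublocale later_arrivals: sequence_space later_arrival
  by unfold_locales

abbreviation arrivals :: "(nat \<Rightarrow> real) measure" where
  "arrivals \<equiv> \<Pi>\<^sub>M i\<in>UNIV. later_arrival"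

lemma sets_later_arrival [simp]: "sets later_arrival = sets borel"
  by (simp add: later_arrival_def)

lemma space_later_arrival [simp]: "space later_arrival = UNIV"
  by (simp add: later_arrival_def)

lemma space_arrivals [simp]: "space arrivals = UNIV"
  by (simp add: space_PiM)

lemma measurable_arrivals_component [measurable]: "(\<lambda>U. U i) \<in> borel_measurable arrivals"
proof -
  have "(\<lambda>U. U i) \<in> arrivals \<rightarrow>\<^sub>M later_arrival"
    by (rule measurable_component_singleton) simp
  then show ?thesis
    by (simp cong: measurable_cong_sets)
qed

lemma measurable_arrivals_eq [measurable]: "Measurable.pred arrivals (\<lambda>U. U i = U j)"
  using borel_measurable_eq[OF measurable_arrivals_component measurable_arrivals_component]
  by (simp add: pred_def)

lemma AE_later_arrival: "AE x in later_arrival. a < x \<and> x \<le> 1 \<and> x \<noteq> y"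
proof -
  have "AE x in lborel. x \<noteq> a \<and> x \<noteq> y"
    using AE_lborel_singleton[of a] AE_lborel_singleton[of y] by eventually_elim simp
  then show ?thesis
    unfolding later_arrival_def by (intro AE_uniform_measureI) (auto elim!: AE_mp)
qed

lemma emeasure_later_arrival_greaterThan:
  assumes "a \<le> s" "s \<le> 1"
  shows "emeasure later_arrival {s<..} = ennreal ((1 - s) / (1 - a))"
proof -
  have "{a..1} \<inter> {s<..} = {s<..1}" using assms by auto
  then show ?thesis
    using assms a_less_1 by (simp add: later_arrival_def divide_ennreal)
qed

text \<open>Exchangeability: all factors of the product measure coincide, so swapping two
  coordinates preserves it.\<close>

lemma nn_integral_arrivals_transpose:
  assumes [measurable]: "f \<in> borel_measurable arrivals"
  shows "(\<integral>\<^sup>+U. f (U \<circ> Transposition.transpose i j) \<partial>arrivals) = (\<integral>\<^sup>+U. f U \<partial>arrivals)"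
proof -
  let ?t = "\<lambda>U :: nat \<Rightarrow> real. U \<circ> Transposition.transpose i j"
  have "distr arrivals arrivals (\<lambda>\<omega>. \<lambda>n\<in>UNIV. \<omega> (Transposition.transpose i j n)) = arrivals"
    by (rule distr_PiM_reindex) (auto intro: later.prob_space_axioms)
  then have eq: "distr arrivals arrivals ?t = arrivals"
    by (simp add: comp_def restrict_UNIV)
  have [measurable]: "?t \<in> arrivals \<rightarrow>\<^sub>M arrivals"
    by (rule measurable_PiM_single') (auto simp: comp_def)
  show ?thesis
    using nn_integral_distr[of ?t arrivals arrivals f] by (simp add: eq)
qed

text \<open>Prepending an independent draw to the sequence reproduces its law. Fubini then allows
  coordinate 0 to be integrated first, with the other coordinates held fixed.\<close>

lemma nn_integral_arrivals_split:
  assumes [measurable]: "f \<in> borel_measurable arrivals"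
  shows "(\<integral>\<^sup>+U. f U \<partial>arrivals) = (\<integral>\<^sup>+U. (\<integral>\<^sup>+x. f (case_nat x U) \<partial>later_arrival) \<partial>arrivals)"
proof -
  interpret pair_sigma_finite later_arrival arrivals
    by unfold_locales
  have "(\<integral>\<^sup>+U. f U \<partial>arrivals)
      = (\<integral>\<^sup>+y. f (case y of (x, U) \<Rightarrow> case_nat x U) \<partial>(later_arrival \<Otimes>\<^sub>M arrivals))"
    by (subst (1) later_arrivals.PiM_iter[symmetric], subst nn_integral_distr) measurable
  also have "\<dots> = (\<integral>\<^sup>+U. (\<integral>\<^sup>+x. f (case_nat x U) \<partial>later_arrival) \<partial>arrivals)"
    by (subst nn_integral_snd[symmetric]) auto
  finally show ?thesis .
qed

lemma AE_arrivals_0: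
  assumes [measurable]: "Measurable.pred arrivals Q"
    and "\<And>U. AE x in later_arrival. Q (case_nat x U)"
  shows "AE U in arrivals. Q U"
proof -
  have "{U \<in> space arrivals. \<not> Q U} \<in> sets arrivals"
    by measurable
  then have [measurable]: "{U. \<not> Q U} \<in> sets arrivals"
    by simp
  have "emeasure arrivals {U. \<not> Q U} = (\<integral>\<^sup>+U. indicator {U. \<not> Q U} U \<partial>arrivals)"
    by simp
  also have "\<dots> = (\<integral>\<^sup>+U. (\<integral>\<^sup>+x. indicator {U. \<not> Q U} (case_nat x U) \<partial>later_arrival) \<partial>arrivals)"
    by (rule nn_integral_arrivals_split) measurable
  also have "\<dots> = (\<integral>\<^sup>+U. (\<integral>\<^sup>+x. 0 \<partial>later_arrival) \<partial>arrivals)"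
    using assms(2) by (intro nn_integral_cong nn_integral_cong_AE) (auto simp: indicator_def elim!: AE_mp)
  finally show ?thesis
    by (subst AE_iff_measurable[of "{U. \<not> Q U}"]) auto
qed

lemma AE_arrivals_transpose:
  assumes [measurable]: "Measurable.pred arrivals Q"
    and "AE U in arrivals. Q (U \<circ> Transposition.transpose i j)"
  shows "AE U in arrivals. Q U"
proof -
  have "{U \<in> space arrivals. \<not> Q U} \<in> sets arrivals"
    by measurable
  then have [measurable]: "{U. \<not> Q U} \<in> sets arrivals"
    by simp
  have "emeasure arrivals {U. \<not> Q U} = (\<integral>\<^sup>+U. indicator {U. \<not> Q U} U \<partial>arrivals)"
    by simp
  also have "\<dots> = (\<integral>\<^sup>+U. indicator {U. \<not> Q U} (U \<circ> Transposition.transpose i j) \<partial>arrivals)"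
    by (rule nn_integral_arrivals_transpose[symmetric]) measurable
  also have "\<dots> = (\<integral>\<^sup>+U. 0 \<partial>arrivals)"
    using assms(2) by (intro nn_integral_cong_AE) (auto simp: indicator_def elim!: AE_mp)
  finally show ?thesis
    by (subst AE_iff_measurable[of "{U. \<not> Q U}"]) auto
qed

text \<open>For fixed remaining coordinates, coordinate 0 almost surely avoids their countably many
  values, because single points are null. Swapping coordinates carries this to every index.\<close>

lemma AE_arrivals_distinct:
  "AE U in arrivals. inj U \<and> (\<forall>i. a < U i \<and> U i \<le> 1)"
proof -
  have 0: "AE U in arrivals. a < U 0 \<and> U 0 \<le> 1 \<and> (\<forall>j. U 0 \<noteq> U (Suc j))"
  proof (rule AE_arrivals_0)
    fix U :: "nat \<Rightarrow> real"
    have "AE x in later_arrival. \<forall>j. a < x \<and> x \<le> 1 \<and> x \<noteq> U j"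
      unfolding AE_all_countable by (intro allI AE_later_arrival)
    then show "AE x in later_arrival. a < case_nat x U 0 \<and> case_nat x U 0 \<le> 1
        \<and> (\<forall>j. case_nat x U 0 \<noteq> case_nat x U (Suc j))"
      by eventually_elim simp
  qed measurable
  have "AE U in arrivals. a < U i \<and> U i \<le> 1 \<and> (\<forall>j. j \<noteq> i \<longrightarrow> U i \<noteq> U j)" for i
  proof (rule AE_arrivals_transpose[where i = 0 and j = i])
    show "AE U in arrivals. a < (U \<circ> Transposition.transpose 0 i) i
        \<and> (U \<circ> Transposition.transpose 0 i) i \<le> 1
        \<and> (\<forall>j. j \<noteq> i \<longrightarrow> (U \<circ> Transposition.transpose 0 i) i \<noteq> (U \<circ> Transposition.transpose 0 i) j)"
      using 0
    proof eventually_elim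
      case (elim U)
      have "U 0 \<noteq> U j" if "j \<noteq> 0" for j
        using that elim by (metis not0_implies_Suc)
      moreover have "Transposition.transpose 0 i j \<noteq> 0" if "j \<noteq> i" for j
        using that by (auto simp: Transposition.transpose_def)
      ultimately show ?case
        using elim by (metis Transposition.transpose_apply_second comp_apply)
    qed
  qed measurable
  then have "AE U in arrivals. \<forall>i. a < U i \<and> U i \<le> 1 \<and> (\<forall>j. j \<noteq> i \<longrightarrow> U i \<noteq> U j)"
    by (subst AE_all_countable) simp
  then show ?thesis
    by eventually_elim (simp add: inj_def, metis)
qed

text \<open>Intersecting with \<open>{a<..1}\<close> makes this a set of arrival times also on the null set where
  \<open>U\<close> leaves that interval; on the null set where \<open>U\<close> has ties, there are fewer than
  \<open>g + 1\<close> arrivals.\<close>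

definition arrival_set :: "nat \<Rightarrow> (nat \<Rightarrow> real) \<Rightarrow> real set" where
  "arrival_set g U = insert a (U ` {..<g} \<inter> {a<..1})"

lemma arrival_set_props:
  "finite (arrival_set g U)" "arrival_set g U \<noteq> {}" "arrival_set g U \<subseteq> {0<..1}"
  using a_pos a_less_1 by (auto simp: arrival_set_def)

lemma counting_path_arrival_set: "counting_path (arrival_path (arrival_set g U))"
  by (intro counting_path_arrival_path arrival_set_props)

text \<open>By induction on \<open>g\<close>: the new time raises the count exactly when it lies in
  \<open>{a<..1}\<close>, is at most \<open>u\<close> and repeats no earlier time. This holds for
  every sequence, including those with ties.\<close>

lemma measurable_card_arrival_set [measurable]:
  "(\<lambda>U. card (arrival_set g U \<inter> {..u})) \<in> arrivals \<rightarrow>\<^sub>M count_space UNIV"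
proof (induction g)
  case 0
  then show ?case by (simp add: arrival_set_def)
next
  case (Suc g)
  have "card (arrival_set (Suc g) U \<inter> {..u}) = card (arrival_set g U \<inter> {..u})
      + (if a < U g \<and> U g \<le> 1 \<and> U g \<le> u \<and> (\<forall>i. i < g \<longrightarrow> U i \<noteq> U g) then 1 else 0)" for U
  proof (cases "a < U g \<and> U g \<le> 1 \<and> U g \<le> u \<and> (\<forall>i. i < g \<longrightarrow> U i \<noteq> U g)")
    case True
    then have "arrival_set (Suc g) U \<inter> {..u} = insert (U g) (arrival_set g U \<inter> {..u})"
      "U g \<notin> arrival_set g U"
      by (auto simp: arrival_set_def lessThan_Suc)
    then show ?thesis
      using True arrival_set_props(1)[of g U] by simp
  next
    case False
    have "arrival_set (Suc g) U \<inter> {..u} = arrival_set g U \<inter> {..u}"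
    proof (cases "U g \<in> {a<..1} \<and> U g \<le> u")
      case True
      then obtain i where "i < g" "U i = U g"
        using False by auto
      then have "U g \<in> U ` {..<g}"
        by (metis imageI lessThan_iff)
      then show ?thesis
        by (simp add: arrival_set_def lessThan_Suc insert_absorb)
    next
      case False
      then have "insert (U g) (U ` {..<g}) \<inter> {a<..1} \<inter> {..u} = U ` {..<g} \<inter> {a<..1} \<inter> {..u}"
        by auto
      then show ?thesis
        by (simp add: arrival_set_def lessThan_Suc Int_insert_left)
    qed
    then show ?thesis
      using False by simp
  qed
  moreover have "(\<lambda>U. card (arrival_set g U \<inter> {..u})
      + (if a < U g \<and> U g \<le> 1 \<and> U g \<le> u \<and> (\<forall>i. i < g \<longrightarrow> U i \<noteq> U g) then 1 else 0))
      \<in> arrivals \<rightarrow>\<^sub>M count_space UNIV"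
  proof -
    note [measurable] = Suc.IH
    have [measurable]: "Measurable.pred arrivals (\<lambda>U. a < U g)" "Measurable.pred arrivals (\<lambda>U. U g \<le> 1)"
      "Measurable.pred arrivals (\<lambda>U. U g \<le> u)"
      by measurable
    show ?thesis by measurable
  qed
  ultimately show ?case by (simp only:)
qed

lemma measurable_card_arrival_set' [measurable]:
  "(\<lambda>U. card (arrival_set g U)) \<in> arrivals \<rightarrow>\<^sub>M count_space UNIV"
proof -
  have "arrival_set g U \<inter> {..1} = arrival_set g U" for U
    using arrival_set_props(3)[of g U] by auto
  then show ?thesis
    using measurable_card_arrival_set[of g 1] by simp
qed

section \<open>Random outcomes and their law\<close>

text \<open>The fallback \<open>id\<close> takes over when the ranking does not fit the actual
  number of arrivals, so that every value lies in \<open>Omega\<close>.\<close>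

definition outcome_of :: "nat \<times> (nat \<Rightarrow> nat) \<Rightarrow> (nat \<Rightarrow> real) \<Rightarrow> outcome" where
  "outcome_of d U = (arrival_path (arrival_set (fst d) U),
     if snd d permutes {1..card (arrival_set (fst d) U)} then snd d else id)"

lemma outcome_of_in_Omega [simp]: "outcome_of d U \<in> Omega"
  using arrival_path_1[OF arrival_set_props(3), of "fst d" U]
  by (auto simp: outcome_of_def Omega_def counting_path_arrival_set permutes_id)

lemma measurable_outcome_of [measurable]: "outcome_of d \<in> arrivals \<rightarrow>\<^sub>M outcome_algebra"
  unfolding outcome_algebra_def
proof (rule measurable_measure_of)
  fix Y assume "Y \<in> {{(n, r) \<in> Omega. n u = k} | u k. u \<in> {0..1}} \<union> {{(n, r) \<in> Omega. r k = j} | k j. True}"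
  then consider u k where "u \<in> {0..1}" "Y = {(n, r) \<in> Omega. n u = k}"
    | k j where "Y = {(n, r) \<in> Omega. r k = j}" by blast
  then show "outcome_of d -` Y \<inter> space arrivals \<in> sets arrivals"
  proof cases
    case 1
    have "outcome_of d -` Y \<inter> space arrivals = {U \<in> space arrivals. card (arrival_set (fst d) U \<inter> {..u}) = k}"
      using 1 outcome_of_in_Omega[of d] by (auto simp: outcome_of_def arrival_path_def)
    also have "\<dots> \<in> sets arrivals"
      by measurable
    finally show ?thesis .
  next
    case 2
    have "outcome_of d -` Y \<inter> space arrivals = {U \<in> space arrivals.
        (\<lambda>c. (if snd d permutes {1..c} then snd d else id) k = j) (card (arrival_set (fst d) U))}"
      using 2 outcome_of_in_Omega[of d] by (auto simp: outcome_of_def)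
    also have "\<dots> \<in> sets arrivals"
      by measurable
    finally show ?thesis .
  qed
qed auto

text \<open>The geometric variable \<open>g\<close> starts at 0, with weights
  \<open>(1 - a) ^ g * a\<close>, and counts the arrivals after \<open>a\<close>. Together with the
  one at \<open>a\<close> there are \<open>Suc g\<close> candidates to rank.\<close>

definition count_and_ranks :: "(nat \<times> (nat \<Rightarrow> nat)) pmf" where
  "count_and_ranks = bind_pmf (geometric_pmf a)
     (\<lambda>g. map_pmf (Pair g) (pmf_of_set {p. p permutes {1..Suc g}}))"

definition law :: "outcome measure" where
  "law = measure_pmf count_and_ranks \<bind> (\<lambda>d. distr arrivals outcome_algebra (outcome_of d))"

lemma prob_space_distr_outcome_of: "prob_space (distr arrivals outcome_algebra (outcome_of d))"
  by (rule prob_space.prob_space_distr) (auto intro: later_arrivals.prob_space_axioms)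

lemma measurable_law_kernel:
  "(\<lambda>d. distr arrivals outcome_algebra (outcome_of d))
     \<in> measure_pmf count_and_ranks \<rightarrow>\<^sub>M prob_algebra outcome_algebra"
  by (auto simp: space_prob_algebra prob_space_distr_outcome_of)

lemma prob_space_law: "prob_space law"
  unfolding law_def
  by (rule prob_space_bind'[OF _ measurable_law_kernel])
    (auto simp: space_prob_algebra measure_pmf.prob_space_axioms)

sublocale prob_space law
  by (rule prob_space_law)

lemma sets_law [measurable_cong, simp]: "sets law = sets outcome_algebra"
  unfolding law_def
  by (rule sets_bind'[OF _ measurable_law_kernel])
    (auto simp: space_prob_algebra measure_pmf.prob_space_axioms)

lemma space_law [simp]: "space law = Omega"
  using sets_eq_imp_space_eq[OF sets_law] by simp

lemma nn_integral_law:
  assumes [measurable]: "f \<in> borel_measurable outcome_algebra"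
  shows "(\<integral>\<^sup>+\<omega>. f \<omega> \<partial>law) = (\<integral>\<^sup>+g. (\<integral>\<^sup>+p. (\<integral>\<^sup>+U. f (outcome_of (g, p) U) \<partial>arrivals)
     \<partial>pmf_of_set {p. p permutes {1..Suc g}}) \<partial>geometric_pmf a)"
proof -
  have "(\<integral>\<^sup>+\<omega>. f \<omega> \<partial>law) = (\<integral>\<^sup>+d. (\<integral>\<^sup>+\<omega>. f \<omega> \<partial>distr arrivals outcome_algebra (outcome_of d)) \<partial>count_and_ranks)"
    unfolding law_def
    by (rule nn_integral_bind[OF assms measurable_prob_algebraD[OF measurable_law_kernel]])
  also have "\<dots> = (\<integral>\<^sup>+d. (\<integral>\<^sup>+U. f (outcome_of d U) \<partial>arrivals) \<partial>count_and_ranks)"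
    by (intro nn_integral_cong nn_integral_distr) auto
  finally show ?thesis
    by (simp add: count_and_ranks_def)
qed

text \<open>For an integrand that ignores the ranks the average over permutations is trivial;
  \<open>id\<close> serves as a placeholder ranking.\<close>

lemma nn_integral_law_counting:
  assumes [measurable]: "f \<in> borel_measurable outcome_algebra"
    and "\<And>n r r'. (n, r) \<in> Omega \<Longrightarrow> (n, r') \<in> Omega \<Longrightarrow> f (n, r) = f (n, r')"
  shows "(\<integral>\<^sup>+\<omega>. f \<omega> \<partial>law) = (\<integral>\<^sup>+g. (\<integral>\<^sup>+U. f (outcome_of (g, id) U) \<partial>arrivals) \<partial>geometric_pmf a)"
proof -
  have "(\<integral>\<^sup>+p. (\<integral>\<^sup>+U. f (outcome_of (g, p) U) \<partial>arrivals) \<partial>pmf_of_set {p. p permutes {1..Suc g}})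
      = (\<integral>\<^sup>+p. (\<integral>\<^sup>+U. f (outcome_of (g, id) U) \<partial>arrivals) \<partial>pmf_of_set {p. p permutes {1..Suc g}})" for g
  proof (intro nn_integral_cong)
    fix p U
    show "f (outcome_of (g, p) U) = f (outcome_of (g, id) U)"
      using outcome_of_in_Omega[of "(g, p)" U] outcome_of_in_Omega[of "(g, id)" U]
      unfolding outcome_of_def fst_conv by (rule assms(2))
  qed
  then show ?thesis
    by (subst nn_integral_law[OF assms(1)]) simp
qed

lemma AE_lawI:
  assumes "{\<omega> \<in> Omega. Q \<omega>} \<in> sets outcome_algebra" and "\<And>d U. Q (outcome_of d U)"
  shows "AE \<omega> in law. Q \<omega>"
proof -
  have [measurable]: "{\<omega> \<in> Omega. Q \<omega>} \<in> sets outcome_algebra" by fact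
  have "emeasure law {\<omega> \<in> Omega. Q \<omega>} = (\<integral>\<^sup>+\<omega>. indicator {\<omega> \<in> Omega. Q \<omega>} \<omega> \<partial>law)"
    by (simp add: nn_integral_indicator)
  also have "\<dots> = 1"
    by (subst nn_integral_law)
      (auto simp: assms(2) measure_pmf.emeasure_space_1[simplified] later_arrivals.emeasure_space_1[simplified])
  finally have "prob {\<omega> \<in> Omega. Q \<omega>} = 1"
    by (simp add: emeasure_eq_measure)
  then show ?thesis
    by (auto dest: AE_prob_1)
qed

subsection \<open>Proportional increments\<close>

text \<open>Memorylessness: the variable is nonzero with probability \<open>1 - a\<close>, and then
  it is one more than a geometric variable of the same parameter.\<close>

lemma nn_integral_geometric_Suc:
  fixes h :: "nat \<Rightarrow> ennreal"
  assumes "h 0 = 0"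
  shows "(\<integral>\<^sup>+g. h g \<partial>geometric_pmf a) = ennreal (1 - a) * (\<integral>\<^sup>+g. h (Suc g) \<partial>geometric_pmf a)"
  using a_pos a_less_1 assms
  by (subst geometric_bind_pmf_unfold) (auto simp: mult.commute)

text \<open>The two arrival sets can differ only in the point \<open>x\<close>, which lies beyond
  \<open>s\<close>, so the two paths agree up to time \<open>s\<close>.\<close>

lemma outcome_of_later_arrival:
  assumes "A \<in> sets (counting_filtration s)" "s < x"
  shows "outcome_of (Suc g, id) (case_nat x U) \<in> A \<longleftrightarrow> outcome_of (g, id) U \<in> A"
proof -
  have "case_nat x U ` {..<Suc g} = insert x (U ` {..<g})"
    by (simp add: lessThan_Suc_eq_insert_0 image_image)
  then have "arrival_set (Suc g) (case_nat x U) \<inter> {..u} = arrival_set g U \<inter> {..u}" if "u \<le> s" for u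
    using assms(2) that by (auto simp: arrival_set_def)
  then show ?thesis
    using outcome_of_in_Omega[of "(Suc g, id)" "case_nat x U"] outcome_of_in_Omega[of "(g, id)" U]
    unfolding outcome_of_def
    by (intro counting_filtration_determined[OF assms(1)]) (simp_all add: arrival_path_def)
qed

lemma outcome_of_transpose:
  assumes "i < g" "j < g"
  shows "outcome_of (g, p) (U \<circ> Transposition.transpose i j) = outcome_of (g, p) U"
proof -
  have "(U \<circ> Transposition.transpose i j) ` {..<g} = U ` {..<g}"
    using assms by (simp only: image_comp[symmetric] transpose_image_eq lessThan_iff)
  then show ?thesis
    by (simp add: outcome_of_def arrival_set_def)
qed

text \<open>An event in the past of \<open>s\<close> does not notice the removal of an arrival after \<open>s\<close>.\<close>

lemma nn_integral_remove_arrival: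
  assumes A: "A \<in> sets (counting_filtration s)" and s: "a \<le> s" "s \<le> 1" and i: "i < Suc g"
  shows "(\<integral>\<^sup>+U. indicator A (outcome_of (Suc g, id) U) * indicator {s<..} (U i) \<partial>arrivals)
    = ennreal ((1 - s) / (1 - a)) * (\<integral>\<^sup>+U. indicator A (outcome_of (g, id) U) \<partial>arrivals)"
proof -
  have [measurable]: "A \<in> sets outcome_algebra"
    using A sets_counting_filtration_outcome_algebra by blast
  define f :: "(nat \<Rightarrow> real) \<Rightarrow> ennreal"
    where "f U = indicator A (outcome_of (Suc g, id) U) * indicator {s<..} (U 0)" for U
  have [measurable]: "f \<in> borel_measurable arrivals"
    unfolding f_def by measurable
  \<comment> \<open>The arrival set is symmetric in the first \<open>Suc g\<close> coordinates, so
    the arrival to be removed may be moved to coordinate 0 and split off from the sequence.\<close>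
  have "(\<integral>\<^sup>+U. indicator A (outcome_of (Suc g, id) U) * indicator {s<..} (U i) \<partial>arrivals)
      = (\<integral>\<^sup>+U. f (U \<circ> Transposition.transpose 0 i) \<partial>arrivals)"
    using i by (intro nn_integral_cong) (simp add: f_def outcome_of_transpose)
  also have "\<dots> = (\<integral>\<^sup>+U. f U \<partial>arrivals)"
    by (rule nn_integral_arrivals_transpose) measurable
  also have "\<dots> = (\<integral>\<^sup>+U. (\<integral>\<^sup>+x. f (case_nat x U) \<partial>later_arrival) \<partial>arrivals)"
    by (rule nn_integral_arrivals_split) measurable
  also have "\<dots> = (\<integral>\<^sup>+U. (\<integral>\<^sup>+x. indicator A (outcome_of (g, id) U) * indicator {s<..} x \<partial>later_arrival) \<partial>arrivals)"
    by (intro nn_integral_cong) (auto simp: f_def indicator_def outcome_of_later_arrival[OF A])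
  also have "\<dots> = (\<integral>\<^sup>+U. indicator A (outcome_of (g, id) U) * emeasure later_arrival {s<..} \<partial>arrivals)"
    by (intro nn_integral_cong) (simp add: nn_integral_cmult_indicator)
  also have "\<dots> = ennreal ((1 - s) / (1 - a)) * (\<integral>\<^sup>+U. indicator A (outcome_of (g, id) U) \<partial>arrivals)"
    unfolding emeasure_later_arrival_greaterThan[OF s]
    by (subst nn_integral_multc) (auto simp: mult.commute)
  finally show ?thesis .
qed

text \<open>Off the null set of ties and of times outside \<open>{a<..1}\<close>, the arrivals after
  \<open>s\<close> correspond to the indices \<open>i < g\<close> with \<open>s < U i\<close>. The
  sum of indicators lets the increment be integrated one arrival at a time.\<close>

lemma AE_count_after:
  assumes "a \<le> s" "s \<le> 1"
  shows "AE U in arrivals. fst (outcome_of (g, p) U) 1 = Suc g \<and>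
    (of_nat (fst (outcome_of (g, p) U) 1 - fst (outcome_of (g, p) U) s) :: ennreal)
      = (\<Sum>i<g. indicator {s<..} (U i))"
  using AE_arrivals_distinct
proof eventually_elim
  case (elim U)
  let ?F = "arrival_set g U"
  have F: "?F = insert a (U ` {..<g})"
    using elim by (auto simp: arrival_set_def)
  have "a \<notin> U ` {..<g}"
    using elim by (metis imageE less_irrefl)
  moreover have "card (U ` {..<g}) = g"
    using elim by (subst card_image) (auto intro: inj_on_subset)
  ultimately have card: "card ?F = Suc g"
    by (simp add: F)
  have "?F - ?F \<inter> {..s} = U ` {i \<in> {..<g}. s < U i}"
    using assms by (auto simp: F)
  then have "card ?F - card (?F \<inter> {..s}) = card {i \<in> {..<g}. s < U i}"
    using elim arrival_set_props(1)[of g U]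
    by (subst card_Diff_subset[symmetric]) (auto intro!: card_image intro: inj_on_subset)
  moreover have "of_nat (card {i \<in> {..<g}. s < U i}) = (\<Sum>i<g. indicator {s<..} (U i) :: ennreal)"
    by (simp add: indicator_def sum.If_cases Int_def)
  ultimately show ?case
    using card assms a_pos arrival_path_1[OF arrival_set_props(3), of g U]
    by (simp add: outcome_of_def) (simp add: arrival_path_def)
qed

text \<open>Summing the removal identity over the later arrivals lowers their number by one, and the
  geometric recursion absorbs this shift. The result holds in extended nonnegative reals, before any
  integrability is known.\<close>

lemma nn_integral_increment:
  assumes A: "A \<in> sets (counting_filtration s)" and s: "a \<le> s" "s \<le> 1"
  shows "(\<integral>\<^sup>+\<omega>. of_nat (fst \<omega> 1 - fst \<omega> s) * indicator A \<omega> \<partial>law)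
    = ennreal (1 - s) * (\<integral>\<^sup>+\<omega>. of_nat (fst \<omega> 1) * indicator A \<omega> \<partial>law)"
proof -
  have [measurable]: "A \<in> sets outcome_algebra"
    using A sets_counting_filtration_outcome_algebra by blast
  have s01: "s \<in> {0..1}" "1 \<in> {0..1::real}"
    using s a_pos by auto
  note [measurable] = measurable_count_outcome_algebra[OF s01(1)] measurable_count_outcome_algebra[OF s01(2)]
  define b where "b g = (\<integral>\<^sup>+U. indicator A (outcome_of (g, id) U) \<partial>arrivals)" for g
  define c where "c = ennreal ((1 - s) / (1 - a))"
  have inv: "indicator A (n, r) = (indicator A (n, r') :: ennreal)"
    if "(n, r) \<in> Omega" "(n, r') \<in> Omega" for n r r'
    using counting_filtration_determined[OF A that] by (simp add: indicator_def)
  define h where "h g = (\<integral>\<^sup>+U. of_nat (fst (outcome_of (g, id) U) 1 - fst (outcome_of (g, id) U) s)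
      * indicator A (outcome_of (g, id) U) \<partial>arrivals)" for g
  have h: "h g = (\<Sum>i<g. (\<integral>\<^sup>+U. indicator A (outcome_of (g, id) U) * indicator {s<..} (U i) \<partial>arrivals))" for g
  proof -
    have "h g = (\<integral>\<^sup>+U. (\<Sum>i<g. indicator A (outcome_of (g, id) U) * indicator {s<..} (U i)) \<partial>arrivals)"
      unfolding h_def
    proof (rule nn_integral_cong_AE)
      show "AE U in arrivals. of_nat (fst (outcome_of (g, id) U) 1 - fst (outcome_of (g, id) U) s)
          * indicator A (outcome_of (g, id) U)
        = (\<Sum>i<g. indicator A (outcome_of (g, id) U) * indicator {s<..} (U i) :: ennreal)"
        using AE_count_after[OF s, of g id]
      proof eventually_elim
        case (elim U)
        show ?case
          unfolding conjunct2[OF elim] sum_distrib_right by (simp only: mult.commute)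
      qed
    qed
    then show ?thesis
      by (subst (asm) nn_integral_sum) auto
  qed
  \<comment> \<open>There are \<open>Suc g\<close> removable later arrivals, and after one removal
    \<open>Suc g\<close> candidates remain in total. This coincidence is what turns the factor
    \<open>of_nat (Suc g)\<close> back into the final count.\<close>
  have hSuc: "h (Suc g) = c * (of_nat (Suc g) * b g)" for g
  proof -
    have "h (Suc g) = (\<Sum>i<Suc g. c * b g)"
      unfolding h b_def c_def by (intro sum.cong refl nn_integral_remove_arrival[OF A s]) simp
    also have "\<dots> = c * (of_nat (Suc g) * b g)"
      by (simp only: sum_constant card_lessThan) (simp only: mult_ac)
    finally show ?thesis .
  qed
  have "(\<integral>\<^sup>+\<omega>. of_nat (fst \<omega> 1 - fst \<omega> s) * indicator A \<omega> \<partial>law) = (\<integral>\<^sup>+g. h g \<partial>geometric_pmf a)"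
    unfolding h_def by (rule nn_integral_law_counting) (measurable, simp only: fst_conv, metis inv)
  also have "\<dots> = ennreal (1 - a) * (\<integral>\<^sup>+g. c * (of_nat (Suc g) * b g) \<partial>geometric_pmf a)"
    unfolding hSuc[symmetric] by (rule nn_integral_geometric_Suc) (simp add: h)
  also have "\<dots> = (ennreal (1 - a) * c) * (\<integral>\<^sup>+g. of_nat (Suc g) * b g \<partial>geometric_pmf a)"
    by (simp add: nn_integral_cmult mult.assoc del: of_nat_Suc)
  \<comment> \<open>The factor \<open>1 - a\<close> from the geometric recursion cancels the
    denominator coming from the uniform density on \<open>{a..1}\<close>.\<close>
  also have "ennreal (1 - a) * c = ennreal (1 - s)"
    unfolding c_def using s a_less_1 by (simp add: ennreal_mult'[symmetric])
  also have "(\<integral>\<^sup>+g. of_nat (Suc g) * b g \<partial>geometric_pmf a)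
      = (\<integral>\<^sup>+g. (\<integral>\<^sup>+U. of_nat (fst (outcome_of (g, id) U) 1) * indicator A (outcome_of (g, id) U) \<partial>arrivals)
          \<partial>geometric_pmf a)"
  proof (rule nn_integral_cong)
    fix g
    have "(\<integral>\<^sup>+U. of_nat (fst (outcome_of (g, id) U) 1) * indicator A (outcome_of (g, id) U) \<partial>arrivals)
        = (\<integral>\<^sup>+U. of_nat (Suc g) * indicator A (outcome_of (g, id) U) \<partial>arrivals)"
    proof (rule nn_integral_cong_AE)
      show "AE U in arrivals. of_nat (fst (outcome_of (g, id) U) 1) * indicator A (outcome_of (g, id) U)
          = (of_nat (Suc g) * indicator A (outcome_of (g, id) U) :: ennreal)"
        using AE_count_after[OF s, of g id] by eventually_elim simp
    qed
    then show "of_nat (Suc g) * b g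
      = (\<integral>\<^sup>+U. of_nat (fst (outcome_of (g, id) U) 1) * indicator A (outcome_of (g, id) U) \<partial>arrivals)"
      unfolding b_def by (simp add: nn_integral_cmult del: of_nat_Suc)
  qed
  also have "\<dots> = (\<integral>\<^sup>+\<omega>. of_nat (fst \<omega> 1) * indicator A \<omega> \<partial>law)"
    by (rule nn_integral_law_counting[symmetric]) (measurable, simp only: fst_conv, metis inv)
  finally show ?thesis .
qed

section \<open>Expectations of the count and of the compensator\<close>

lemma integrable_total_count: "integrable law (\<lambda>\<omega>. real (fst \<omega> 1))"
proof (rule integrableI_nonneg)
  have [measurable]: "(\<lambda>\<omega>. fst \<omega> 1) \<in> outcome_algebra \<rightarrow>\<^sub>M count_space UNIV"
    by (rule measurable_count_outcome_algebra) simp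
  show "(\<lambda>\<omega>. real (fst \<omega> 1)) \<in> borel_measurable law"
    by measurable
  have "(\<integral>\<^sup>+\<omega>. ennreal (real (fst \<omega> 1)) \<partial>law)
      = (\<integral>\<^sup>+g. (\<integral>\<^sup>+U. ennreal (real (fst (outcome_of (g, id) U) 1)) \<partial>arrivals) \<partial>geometric_pmf a)"
    by (rule nn_integral_law_counting) auto
  also have "\<dots> = (\<integral>\<^sup>+g. ennreal (1 + real g) \<partial>geometric_pmf a)"
  proof (rule nn_integral_cong)
    fix g
    have "(\<integral>\<^sup>+U. ennreal (real (fst (outcome_of (g, id) U) 1)) \<partial>arrivals)
        = (\<integral>\<^sup>+U. ennreal (1 + real g) \<partial>arrivals)"
      using AE_count_after[of 1 g id] a_less_1
      by (intro nn_integral_cong_AE) (auto elim!: AE_mp)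
    then show "(\<integral>\<^sup>+U. ennreal (real (fst (outcome_of (g, id) U) 1)) \<partial>arrivals) = ennreal (1 + real g)"
      by (simp add: later_arrivals.emeasure_space_1[simplified])
  qed
  also have "\<dots> < \<infinity>"
  proof -
    have "integrable (geometric_pmf a) (\<lambda>g. 1 + real g)"
      using a_pos a_less_1 by (intro Bochner_Integration.integrable_add integrable_real_geometric_pmf) auto
    then show ?thesis
      by (simp add: integrable_iff_bounded)
  qed
  finally show "(\<integral>\<^sup>+\<omega>. ennreal (real (fst \<omega> 1)) \<partial>law) < \<infinity>" .
qed simp

text \<open>The increment identity is subtracted from the expectation of the final count on
  \<open>A\<close>; integrability of the latter makes the subtraction legitimate. Monotonicity of
  paths identifies the difference of natural numbers with the real one.\<close>

lemma has_bochner_integral_count: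
  assumes A: "A \<in> sets (counting_filtration t)" and t: "a \<le> t" "t \<le> 1"
  shows "has_bochner_integral law (\<lambda>\<omega>. real (fst \<omega> t) * indicator A \<omega>)
    (t * (\<integral>\<omega>. real (fst \<omega> 1) * indicator A \<omega> \<partial>law))"
proof -
  have [measurable]: "A \<in> sets outcome_algebra"
    using A sets_counting_filtration_outcome_algebra by blast
  have t01: "t \<in> {0..1}" "1 \<in> {0..1::real}"
    using t a_pos by auto
  note [measurable] = measurable_count_outcome_algebra[OF t01(1)] measurable_count_outcome_algebra[OF t01(2)]
  let ?m = "\<integral>\<omega>. real (fst \<omega> 1) * indicator A \<omega> \<partial>law"
  have int1: "integrable law (\<lambda>\<omega>. real (fst \<omega> 1) * indicator A \<omega>)"
    by (intro integrable_real_mult_indicator integrable_total_count) simp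
  have "(\<integral>\<^sup>+\<omega>. ennreal (real (fst \<omega> 1) * indicator A \<omega>) \<partial>law) = ennreal ?m"
    using int1 by (intro nn_integral_eq_integral) auto
  then have m: "(\<integral>\<^sup>+\<omega>. of_nat (fst \<omega> 1) * indicator A \<omega> \<partial>law) = ennreal ?m"
    by (simp add: ennreal_mult ennreal_of_nat_eq_real_of_nat ennreal_indicator)
  have "(\<integral>\<^sup>+\<omega>. ennreal (real (fst \<omega> 1 - fst \<omega> t) * indicator A \<omega>) \<partial>law)
      = (\<integral>\<^sup>+\<omega>. of_nat (fst \<omega> 1 - fst \<omega> t) * indicator A \<omega> \<partial>law)"
    by (simp add: ennreal_mult ennreal_of_nat_eq_real_of_nat ennreal_indicator)
  also have "\<dots> = ennreal ((1 - t) * ?m)"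
    using t by (simp add: nn_integral_increment[OF A t] m ennreal_mult')
  finally have "has_bochner_integral law (\<lambda>\<omega>. real (fst \<omega> 1 - fst \<omega> t) * indicator A \<omega>) ((1 - t) * ?m)"
    using t by (intro has_bochner_integral_nn_integral) (auto intro!: mult_nonneg_nonneg Bochner_Integration.integral_nonneg)
  from has_bochner_integral_diff[OF has_bochner_integral_integrable[OF int1] this]
  have "has_bochner_integral law (\<lambda>\<omega>. real (fst \<omega> 1) * indicator A \<omega>
      - real (fst \<omega> 1 - fst \<omega> t) * indicator A \<omega>) (t * ?m)"
    by (simp add: algebra_simps)
  then show ?thesis
  proof (rule has_bochner_integral_cong[THEN iffD1, rotated -1])
    fix \<omega> assume "\<omega> \<in> space law"
    then have "fst \<omega> t \<le> fst \<omega> 1"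
      using t a_pos by (auto simp: Omega_def intro: counting_path_monoD)
    then show "real (fst \<omega> 1) * indicator A \<omega> - real (fst \<omega> 1 - fst \<omega> t) * indicator A \<omega>
        = real (fst \<omega> t) * indicator A \<omega>"
      by (simp add: of_nat_diff algebra_simps)
  qed auto
qed

lemma measurable_law_counting_filtration: "(\<lambda>\<omega>. \<omega>) \<in> law \<rightarrow>\<^sub>M counting_filtration t"
  using sets_counting_filtration_outcome_algebra[of t] sets.sets_into_space[of _ law]
  by (intro measurableI) (auto simp: Int_absorb2)

text \<open>After exchanging the integrals, the inner expectation of the count at \<open>u\<close>
  divided by \<open>u\<close>, on \<open>A\<close>, is the same for every \<open>u\<close> between
  \<open>s\<close> and \<open>t\<close>: the factor \<open>u\<close> cancels. This constant is then
  integrated over an interval of length \<open>t - s\<close>.\<close>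

lemma has_bochner_integral_compensator:
  assumes A: "A \<in> sets (counting_filtration s)" and st: "a \<le> s" "s \<le> t" "t \<le> 1"
  shows "has_bochner_integral law (\<lambda>\<omega>. integral {s..t} (\<lambda>u. real (fst \<omega> u) / u) * indicator A \<omega>)
    ((t - s) * (\<integral>\<omega>. real (fst \<omega> 1) * indicator A \<omega> \<partial>law))"
proof -
  interpret pair_sigma_finite law lborel
    by unfold_locales
  have [measurable]: "A \<in> sets outcome_algebra"
    using A sets_counting_filtration_outcome_algebra by blast
  let ?m = "\<integral>\<omega>. real (fst \<omega> 1) * indicator A \<omega> \<partial>law"
  have "0 \<le> ?m" by (intro Bochner_Integration.integral_nonneg) auto
  define g where "g = (\<lambda>(\<omega> :: outcome, u :: real). real (fst \<omega> u) / u * indicator {s<..<t} u)"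
  have "(\<lambda>x. case (fst x, snd x) of (\<omega>, u) \<Rightarrow> real (fst \<omega> u) * indicator {0<..<1} u)
      \<in> borel_measurable (law \<Otimes>\<^sub>M lborel)"
    by (rule measurable_compose[OF measurable_Pair[OF
          measurable_compose[OF measurable_fst measurable_law_counting_filtration] measurable_snd]
          measurable_counting_path_joint]) simp_all
  then have "(\<lambda>x. (case (fst x, snd x) of (\<omega>, u) \<Rightarrow> real (fst \<omega> u) * indicator {0<..<1} u)
      * (indicator {s<..<t} (snd x) / snd x)) \<in> borel_measurable (law \<Otimes>\<^sub>M lborel)"
    by measurable
  also have "(\<lambda>x. (case (fst x, snd x) of (\<omega>, u) \<Rightarrow> real (fst \<omega> u) * indicator {0<..<1} u)
      * (indicator {s<..<t} (snd x) / snd x)) = g"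
    using st a_pos by (auto simp: g_def fun_eq_iff indicator_def)
  finally have g_meas [measurable]: "g \<in> borel_measurable (law \<Otimes>\<^sub>M lborel)" .
  have g_nonneg: "0 \<le> g (\<omega>, u)" for \<omega> u
    using st a_pos by (auto simp: g_def indicator_def)
  have J: "integrable lborel (\<lambda>u. g (\<omega>, u))"
      "integral {s..t} (\<lambda>u. real (fst \<omega> u) / u) = (LBINT u. g (\<omega>, u))" if "\<omega> \<in> Omega" for \<omega>
    using that st a_pos counting_path_integral(1,2)[of "fst \<omega>" s t] by (auto simp: Omega_def g_def)
  have "(\<integral>\<^sup>+\<omega>. ennreal ((LBINT u. g (\<omega>, u)) * indicator A \<omega>) \<partial>law)
      = (\<integral>\<^sup>+\<omega>. (\<integral>\<^sup>+u. ennreal (g (\<omega>, u) * indicator A \<omega>) \<partial>lborel) \<partial>law)"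
  proof (rule nn_integral_cong)
    fix \<omega> assume "\<omega> \<in> space law"
    then have "(\<integral>\<^sup>+u. ennreal (g (\<omega>, u)) \<partial>lborel) = ennreal (LBINT u. g (\<omega>, u))"
      using g_nonneg by (intro nn_integral_eq_integral J(1)) auto
    then show "ennreal ((LBINT u. g (\<omega>, u)) * indicator A \<omega>)
        = (\<integral>\<^sup>+u. ennreal (g (\<omega>, u) * indicator A \<omega>) \<partial>lborel)"
      by (simp add: indicator_def)
  qed
  also have "\<dots> = (\<integral>\<^sup>+u. (\<integral>\<^sup>+\<omega>. ennreal (g (\<omega>, u) * indicator A \<omega>) \<partial>law) \<partial>lborel)"
    by (rule Fubini'[symmetric]) measurable
  also have "\<dots> = (\<integral>\<^sup>+u. ennreal ?m * indicator {s<..<t} u \<partial>lborel)"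
  proof (rule nn_integral_cong)
    fix u :: real
    show "(\<integral>\<^sup>+\<omega>. ennreal (g (\<omega>, u) * indicator A \<omega>) \<partial>law) = ennreal ?m * indicator {s<..<t} u"
    proof (cases "u \<in> {s<..<t}")
      case True
      then have "A \<in> sets (counting_filtration u)" "a \<le> u" "u \<le> 1"
        using A sets_counting_filtration_mono[of s u] st by auto
      from has_bochner_integral_mult_right[OF has_bochner_integral_count[OF this], of "1 / u"]
      have "has_bochner_integral law (\<lambda>\<omega>. g (\<omega>, u) * indicator A \<omega>) ?m"
        using True st a_pos by (simp add: g_def)
      then have "(\<integral>\<^sup>+\<omega>. ennreal (g (\<omega>, u) * indicator A \<omega>) \<partial>law) = ennreal ?m"
        using g_nonneg
        by (subst nn_integral_eq_integral) (auto simp: has_bochner_integral_iff)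
      then show ?thesis
        using True by simp
    qed (simp add: g_def)
  qed
  also have "\<dots> = ennreal ((t - s) * ?m)"
    using st by (subst nn_integral_cmult_indicator) (simp_all add: ennreal_mult' mult.commute)
  finally have "has_bochner_integral law (\<lambda>\<omega>. (LBINT u. g (\<omega>, u)) * indicator A \<omega>) ((t - s) * ?m)"
    using st \<open>0 \<le> ?m\<close> g_nonneg
    by (intro has_bochner_integral_nn_integral) (auto intro!: mult_nonneg_nonneg Bochner_Integration.integral_nonneg)
  then show ?thesis
    by (rule has_bochner_integral_cong[THEN iffD1, rotated -1]) (auto simp: J(2))
qed

section \<open>The martingale property\<close>

text \<open>Vanishing at all rational times before \<open>a\<close> is a countable requirement and
  hence holds almost surely. A first arrival before \<open>a\<close> would be followed by a rational
  time before \<open>a\<close> with positive count.\<close>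

lemma AE_law_first_arrival: "AE \<omega> in law. first_arrival (fst \<omega>) = a \<and> fst \<omega> a = 1"
proof -
  have one: "AE \<omega> in law. fst \<omega> a = 1"
  proof (rule AE_lawI)
    have [measurable]: "(\<lambda>\<omega>. fst \<omega> a) \<in> outcome_algebra \<rightarrow>\<^sub>M count_space UNIV"
      using a_pos a_less_1 by (intro measurable_count_outcome_algebra) auto
    have "{\<omega> \<in> space outcome_algebra. fst \<omega> a = 1} \<in> sets outcome_algebra"
      by measurable
    then show "{\<omega> \<in> Omega. fst \<omega> a = 1} \<in> sets outcome_algebra"
      by simp
    fix d :: "nat \<times> (nat \<Rightarrow> nat)" and U
    have "arrival_set (fst d) U \<inter> {..a} = {a}"
      by (auto simp: arrival_set_def)
    then show "fst (outcome_of d U) a = 1"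
      using a_pos a_less_1 by (simp add: outcome_of_def arrival_path_def)
  qed
  have "AE \<omega> in law. fst \<omega> q = 0" if "0 \<le> q" "q < a" for q :: real
  proof (rule AE_lawI)
    have [measurable]: "(\<lambda>\<omega>. fst \<omega> q) \<in> outcome_algebra \<rightarrow>\<^sub>M count_space UNIV"
      using that a_less_1 by (intro measurable_count_outcome_algebra) auto
    have "{\<omega> \<in> space outcome_algebra. fst \<omega> q = 0} \<in> sets outcome_algebra"
      by measurable
    then show "{\<omega> \<in> Omega. fst \<omega> q = 0} \<in> sets outcome_algebra"
      by simp
    fix d :: "nat \<times> (nat \<Rightarrow> nat)" and U
    have "arrival_set (fst d) U \<inter> {..q} = {}"
      using that by (auto simp: arrival_set_def)
    then show "fst (outcome_of d U) q = 0"
      using that a_less_1 by (simp add: outcome_of_def arrival_path_def)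
  qed
  then have zero: "AE \<omega> in law. \<forall>q\<in>\<rat> \<inter> {0..<a}. fst \<omega> q = 0"
    by (subst AE_ball_countable) (auto intro: countable_rat countable_Int1)
  have "AE \<omega> in law. \<omega> \<in> Omega"
    using AE_space[of law] by simp
  with one zero show ?thesis
  proof eventually_elim
    case (elim \<omega>)
    then have n: "counting_path (fst \<omega>)"
      by (auto simp: Omega_def)
    note T = first_arrival_props[OF n]
    have "\<not> first_arrival (fst \<omega>) < a"
    proof
      assume "first_arrival (fst \<omega>) < a"
      then obtain q where q: "q \<in> \<rat>" "first_arrival (fst \<omega>) < q" "q < a"
        using Rats_dense_in_real by blast
      then have "fst \<omega> q = 0"
        using elim T(1) by auto
      moreover have "1 \<le> fst \<omega> q"
        using q a_less_1 by (intro T(5)) auto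
      ultimately show False by simp
    qed
    moreover have "\<not> a < first_arrival (fst \<omega>)"
      using T(4)[of a] elim a_pos by auto
    ultimately show ?case
      using elim by auto
  qed
qed

text \<open>The conditional expectation is characterised by integrals over the events
  \<open>A\<close> in the past of \<open>s\<close>. On each such event the count contributes
  \<open>t' - s'\<close> times the expected final count on \<open>A\<close>, and the compensator
  contributes the same amount.\<close>

lemma is_martingale_compensated: "is_martingale law {0<..1} counting_filtration compensated"
proof -
  have sub: "subalgebra law (counting_filtration t)" for t
    by (rule subalgebra_counting_filtration) simp
  have meas: "compensated t \<in> borel_measurable law" if "0 < t" "t \<le> 1" for t
    using measurable_from_subalg[OF sub measurable_compensated[OF that]] .
  have diff: "integrable law (\<lambda>\<omega>. (compensated t \<omega> - compensated s \<omega>) * indicator A \<omega>)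
      \<and> (\<integral>\<omega>. (compensated t \<omega> - compensated s \<omega>) * indicator A \<omega> \<partial>law) = 0"
    if A: "A \<in> sets (counting_filtration s)" and st: "0 < s" "s \<le> t" "t \<le> 1" for A s t
  proof -
    \<comment> \<open>Almost surely the process is zero up to \<open>a\<close>, so both times may be
      raised to at least \<open>a\<close>, where the expectation identities apply.\<close>
    define s' where "s' = max s a"
    define t' where "t' = max t a"
    have st': "a \<le> s'" "s' \<le> t'" "t' \<le> 1"
      using st a_less_1 by (auto simp: s'_def t'_def)
    have "s \<le> s'" "s \<le> t'"
      using st by (auto simp: s'_def t'_def)
    then have A': "A \<in> sets (counting_filtration s')" "A \<in> sets (counting_filtration t')"
      using A sets_counting_filtration_mono by blast+
    have [measurable]: "A \<in> sets outcome_algebra"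
      using A sets_counting_filtration_outcome_algebra by blast
    let ?f = "\<lambda>\<omega>. (compensated t \<omega> - compensated s \<omega>) * indicator A \<omega>"
    let ?g = "\<lambda>\<omega>. real (fst \<omega> t') * indicator A \<omega> - real (fst \<omega> s') * indicator A \<omega>
      - integral {s'..t'} (\<lambda>u. real (fst \<omega> u) / u) * indicator A \<omega>"
    have "has_bochner_integral law ?g (t' * (\<integral>\<omega>. real (fst \<omega> 1) * indicator A \<omega> \<partial>law)
      - s' * (\<integral>\<omega>. real (fst \<omega> 1) * indicator A \<omega> \<partial>law)
      - (t' - s') * (\<integral>\<omega>. real (fst \<omega> 1) * indicator A \<omega> \<partial>law))"
      using st' A' by (intro has_bochner_integral_diff has_bochner_integral_count
        has_bochner_integral_compensator) auto
    then have g: "has_bochner_integral law ?g 0"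
      by (simp add: algebra_simps)
    have eq: "AE \<omega> in law. ?f \<omega> = ?g \<omega>"
      using AE_law_first_arrival AE_space
    proof eventually_elim
      case (elim \<omega>)
      then have n: "counting_path (fst \<omega>)"
        by (auto simp: Omega_def)
      have "integral {a..s'} (\<lambda>u. real (fst \<omega> u) / u) + integral {s'..t'} (\<lambda>u. real (fst \<omega> u) / u)
          = integral {a..t'} (\<lambda>u. real (fst \<omega> u) / u)"
        using st' a_pos
        by (intro Henstock_Kurzweil_Integration.integral_combine counting_path_integral(3)[OF n]) auto
      then show ?case
        using elim by (auto simp: compensated_def Let_def case_prod_beta s'_def t'_def indicator_def)
    qed
    have f_meas: "?f \<in> borel_measurable law"
      using st by (intro borel_measurable_times borel_measurable_diff meas borel_measurable_indicator) auto
    have g_meas: "?g \<in> borel_measurable law"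
      using g by (rule borel_measurable_has_bochner_integral)
    show ?thesis
      using g unfolding has_bochner_integral_iff
        integrable_cong_AE[OF f_meas g_meas eq] integral_cong_AE[OF f_meas g_meas eq] .
  qed
  have null: "AE \<omega> in law. compensated s \<omega> = 0" if "0 < s" "s \<le> a" for s
    using AE_law_first_arrival
    by eventually_elim (use that in \<open>auto simp: compensated_def Let_def case_prod_beta max_def\<close>)
  have int: "integrable law (compensated t)" if t: "0 < t" "t \<le> 1" for t
  proof -
    \<comment> \<open>At this time \<open>compensated\<close> vanishes almost surely, so
      integrability of the increment on all of \<open>Omega\<close> is integrability of
      \<open>compensated t\<close>.\<close>
    define s where "s = min t a"
    have s: "0 < s" "s \<le> a" "s \<le> t"
      using t a_pos by (auto simp: s_def)
    have "integrable law (\<lambda>\<omega>. (compensated t \<omega> - compensated s \<omega>) * indicator Omega \<omega>)"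
      using diff[of Omega s t] s t sets.top[of "counting_filtration s"] by simp
    then show ?thesis
    proof (rule integrable_cong_AE_imp)
      show "compensated t \<in> borel_measurable law"
        using t by (rule meas)
      show "AE \<omega> in law. (compensated t \<omega> - compensated s \<omega>) * indicator Omega \<omega> = compensated t \<omega>"
        using null[OF s(1,2)] AE_space by eventually_elim simp
    qed
  qed
  show ?thesis
    unfolding is_martingale_def
  proof (intro conjI ballI impI)
    fix s t :: real assume st: "s \<in> {0<..1}" "t \<in> {0<..1}" "s \<le> t"
    interpret sub: finite_measure_subalgebra law "counting_filtration s"
      by unfold_locales (rule sub)
    show "AE \<omega> in law. real_cond_exp law (counting_filtration s) (compensated t) \<omega> = compensated s \<omega>"
    proof (rule sub.real_cond_exp_charact)
      fix A assume A: "A \<in> sets (counting_filtration s)"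
      then have [measurable]: "A \<in> sets outcome_algebra"
        using sets_counting_filtration_outcome_algebra by auto
      have "integrable law (\<lambda>\<omega>. compensated t \<omega> * indicator A \<omega>)"
        "integrable law (\<lambda>\<omega>. compensated s \<omega> * indicator A \<omega>)"
        using st int by (auto intro!: integrable_real_mult_indicator)
      then have "(\<integral>\<omega>. compensated t \<omega> * indicator A \<omega> \<partial>law)
          - (\<integral>\<omega>. compensated s \<omega> * indicator A \<omega> \<partial>law) = 0"
        using diff[OF A, of t] st by (simp add: left_diff_distrib)
      then show "(\<integral>\<omega>\<in>A. compensated t \<omega> \<partial>law) = (\<integral>\<omega>\<in>A. compensated s \<omega> \<partial>law)"
        by (simp add: set_lebesgue_integral_def mult.commute)
    qed (use st int measurable_compensated in auto)
  qed (use sub int measurable_compensated in auto)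
qed

section \<open>Uniformity of the ranks\<close>

text \<open>Without ties there are exactly \<open>Suc g\<close> arrivals, so the fallback ranking in
  \<open>outcome_of\<close> does not come into play.\<close>

lemma AE_outcome_of_ranks:
  assumes "p permutes {1..Suc g}"
  shows "AE U in arrivals. outcome_of (g, p) U = (arrival_path (arrival_set g U), p) \<and>
    arrival_path (arrival_set g U) 1 = Suc g"
  using AE_count_after[OF less_imp_le[OF a_less_1] order_refl, of g p]
proof eventually_elim
  case (elim U)
  then show ?case
    using assms by (simp add: outcome_of_def arrival_path_1[OF arrival_set_props(3)])
qed

lemma emeasure_uniform_permutation:
  assumes "p permutes {1..m}"
  shows "emeasure (measure_pmf (pmf_of_set {p. p permutes {1..m}})) {p} = ennreal (1 / fact m)"
proof -
  have "{p. p permutes {1..m}} \<noteq> {}" "finite {p. p permutes {1..m}}"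
    using assms by (auto simp: finite_permutations)
  then show ?thesis
    using assms by (simp add: emeasure_pmf_single card_permutations)
qed

text \<open>Because \<open>E\<close> ignores the ranks, membership in \<open>Y\<close> factors into
  the event that the drawn permutation is \<open>p\<close> and an event \<open>X\<close> of the path
  alone. The two are independent given \<open>g\<close>.\<close>

lemma uniform_ranks_law: "uniform_ranks law"
  unfolding uniform_ranks_def
proof (intro ballI allI impI)
  fix E m p
  assume E: "E \<in> sets (counting_filtration 1)" and p: "p permutes {1..m :: nat}"
  have [measurable]: "E \<in> sets outcome_algebra"
    using E sets_counting_filtration_outcome_algebra by blast
  note [measurable] = measurable_rank_outcome_algebra
  have [measurable]: "(\<lambda>\<omega>. fst \<omega> 1) \<in> outcome_algebra \<rightarrow>\<^sub>M count_space UNIV"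
    by (rule measurable_count_outcome_algebra) simp
  define X where "X = E \<inter> {(n, r) \<in> Omega. n 1 = m}"
  define Y where "Y = E \<inter> {(n, r) \<in> Omega. n 1 = m \<and> r = p}"
  have "E \<inter> {\<omega> \<in> space outcome_algebra. fst \<omega> 1 = m} \<in> sets outcome_algebra"
    by measurable
  also have "E \<inter> {\<omega> \<in> space outcome_algebra. fst \<omega> 1 = m} = X"
    by (auto simp: X_def)
  finally have [measurable]: "X \<in> sets outcome_algebra" .
  have "E \<inter> {\<omega> \<in> space outcome_algebra. fst \<omega> 1 = m \<and> (\<forall>k. snd \<omega> k = p k)} \<in> sets outcome_algebra"
    by measurable
  also have "E \<inter> {\<omega> \<in> space outcome_algebra. fst \<omega> 1 = m \<and> (\<forall>k. snd \<omega> k = p k)} = Y"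
    by (auto simp: Y_def fun_eq_iff)
  finally have [measurable]: "Y \<in> sets outcome_algebra" .
  have E_iff: "(n, r) \<in> E \<longleftrightarrow> (n, r') \<in> E" if "(n, r) \<in> Omega" "(n, r') \<in> Omega" for n r r'
    using counting_filtration_determined[OF E that] by simp
  define x where "x g = (\<integral>\<^sup>+U. indicator X (outcome_of (g, id) U) \<partial>arrivals)" for g
  have "(\<integral>\<^sup>+q. (\<integral>\<^sup>+U. indicator Y (outcome_of (g, q) U) \<partial>arrivals) \<partial>pmf_of_set {p. p permutes {1..Suc g}})
      = ennreal (1 / fact m) * x g" for g
  proof -
    let ?D = "measure_pmf (pmf_of_set {p. p permutes {1..Suc g}})"
    have "(\<integral>\<^sup>+q. (\<integral>\<^sup>+U. indicator Y (outcome_of (g, q) U) \<partial>arrivals) \<partial>?D)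
        = (\<integral>\<^sup>+q. indicator {p} q * x g \<partial>?D)"
    proof (rule nn_integral_cong_AE, subst AE_measure_pmf_iff, safe)
      fix q assume "q \<in> set_pmf (pmf_of_set {p. p permutes {1..Suc g}})"
      then have q: "q permutes {1..Suc g}"
        by (simp only: set_pmf_permutations mem_Collect_eq)
      have "(\<integral>\<^sup>+U. indicator Y (outcome_of (g, q) U) \<partial>arrivals)
          = (\<integral>\<^sup>+U. indicator {p} q * indicator X (outcome_of (g, id) U) \<partial>arrivals)"
      proof (rule nn_integral_cong_AE)
        show "AE U in arrivals. (indicator Y (outcome_of (g, q) U) :: ennreal)
            = indicator {p} q * indicator X (outcome_of (g, id) U)"
          using AE_outcome_of_ranks[OF q] AE_outcome_of_ranks[OF permutes_id, of g]
        proof eventually_elim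
          case (elim U)
          have "(arrival_path (arrival_set g U), q) \<in> Omega" "(arrival_path (arrival_set g U), id) \<in> Omega"
            using outcome_of_in_Omega[of "(g, q)" U] outcome_of_in_Omega[of "(g, id)" U] elim by simp_all
          then show ?case
            using elim E_iff[of "arrival_path (arrival_set g U)" q id]
            by (auto simp: X_def Y_def indicator_def)
        qed
      qed
      then show "(\<integral>\<^sup>+U. indicator Y (outcome_of (g, q) U) \<partial>arrivals) = indicator {p} q * x g"
        by (simp add: nn_integral_cmult x_def)
    qed
    also have "\<dots> = emeasure ?D {p} * x g"
      by (simp add: nn_integral_multc)
    also have "\<dots> = ennreal (1 / fact m) * x g"
    proof (cases "Suc g = m")
      case True
      then show ?thesis
        using emeasure_uniform_permutation[OF p] by simp
    next
      case False
      \<comment> \<open>Here \<open>p\<close> may still be a permutation of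
        \<open>{1..Suc g}\<close> with a weight other than \<open>1 / fact m\<close>, but the total
        count is almost surely not \<open>m\<close>, so both sides vanish.\<close>
      have "x g = (\<integral>\<^sup>+U. 0 \<partial>arrivals)"
        unfolding x_def
      proof (rule nn_integral_cong_AE)
        show "AE U in arrivals. indicator X (outcome_of (g, id) U) = (0 :: ennreal)"
          using AE_outcome_of_ranks[OF permutes_id, of g]
          by eventually_elim (use False in \<open>simp add: X_def indicator_def\<close>)
      qed
      then show ?thesis by simp
    qed
    finally show ?thesis .
  qed
  then have "(\<integral>\<^sup>+\<omega>. indicator Y \<omega> \<partial>law) = (\<integral>\<^sup>+g. ennreal (1 / fact m) * x g \<partial>geometric_pmf a)"
    by (subst nn_integral_law) simp_all
  also have "\<dots> = ennreal (1 / fact m) * (\<integral>\<^sup>+g. x g \<partial>geometric_pmf a)"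
    by (rule nn_integral_cmult) simp
  also have "(\<integral>\<^sup>+g. x g \<partial>geometric_pmf a) = (\<integral>\<^sup>+\<omega>. indicator X \<omega> \<partial>law)"
    unfolding x_def
  proof (rule nn_integral_law_counting[symmetric])
    fix n r r' assume "(n, r) \<in> Omega" "(n, r') \<in> Omega"
    then show "indicator X (n, r) = (indicator X (n, r') :: ennreal)"
      using E_iff[of n r r'] by (simp add: X_def indicator_def)
  qed measurable
  finally have "emeasure law Y = ennreal (1 / fact m) * emeasure law X"
    by simp
  then have "prob Y = prob X / fact m"
    by (simp add: emeasure_eq_measure ennreal_mult'[symmetric] del: ennreal_1)
  then show "prob (E \<inter> {(n, r) \<in> Omega. n 1 = m \<and> r = p}) = prob (E \<inter> {(n, r) \<in> Omega. n 1 = m}) / fact m"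
    by (simp add: X_def Y_def)
qed

lemma law_in_pi_laws: "law \<in> pi_laws"
  by (simp add: pi_laws_def prob_space_law uniform_ranks_law is_martingale_compensated)

subsection \<open>Stopping at the first arrival\<close>

lemma sets_first_best: "{\<omega> \<in> Omega. snd \<omega> 1 = 1} \<in> sets outcome_algebra"
proof -
  note [measurable] = measurable_rank_outcome_algebra
  have "{\<omega> \<in> space outcome_algebra. snd \<omega> 1 = 1} \<in> sets outcome_algebra"
    by measurable
  then show ?thesis by simp
qed

text \<open>The permutations that fix 1 are those of \<open>{2..Suc g}\<close>; there are
  \<open>fact g\<close> of them among \<open>fact (Suc g)\<close>.\<close>

lemma emeasure_first_fixed:
  "emeasure (measure_pmf (pmf_of_set {p. p permutes {1..Suc g}})) {p. p 1 = 1} = ennreal (1 / real (Suc g))"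
proof -
  let ?S = "{p. p permutes {1..Suc g}}"
  have "?S \<inter> {p. p 1 = 1} = {p. p permutes {2..Suc g}}"
  proof safe
    fix p :: "nat \<Rightarrow> nat" assume p: "p permutes {1..Suc g}" "p 1 = 1"
    have "{1..Suc g} - {2..Suc g} = {1}"
      by auto
    with p(2) have "p x = x" if "x \<in> {1..Suc g} - {2..Suc g}" for x
      using that by simp
    then show "p permutes {2..Suc g}"
      by (rule permutes_superset[OF p(1)])
  next
    fix p :: "nat \<Rightarrow> nat" assume p: "p permutes {2..Suc g}"
    then show "p permutes {1..Suc g}"
      by (rule permutes_subset) auto
    from p show "p 1 = 1"
      by (rule permutes_not_in) simp
  qed
  then have "card (?S \<inter> {p. p 1 = 1}) = fact g"
    by (simp add: card_permutations)
  moreover have "card ?S = fact (Suc g)"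
    by (rule card_permutations) auto
  moreover have "emeasure (measure_pmf (pmf_of_set ?S)) {p. p 1 = 1}
      = ennreal (real (card (?S \<inter> {p. p 1 = 1})) / real (card ?S))"
    using permutes_id[of "{1..Suc g}"] by (intro emeasure_pmf_of_set finite_permutations) blast+
  ultimately have "emeasure (measure_pmf (pmf_of_set ?S)) {p. p 1 = 1}
      = ennreal (real (fact g) / real (fact (Suc g)))"
    by (simp only:)
  also have "real (fact g) / real (fact (Suc g)) = 1 / real (Suc g)"
    by (simp only: fact_Suc of_nat_id of_nat_mult) simp
  finally show ?thesis .
qed

text \<open>Given \<open>g\<close> later arrivals the first candidate is best with probability
  \<open>1 / Suc g\<close>. The probability is thus a series of nonnegative terms, bounded below by
  any partial sum; a few terms will suffice.\<close>

lemma prob_first_best_ge: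
  "(\<Sum>g<N. (1 - a) ^ g * a / real (Suc g)) \<le> prob {\<omega> \<in> Omega. snd \<omega> 1 = 1}"
proof -
  note [measurable] = sets_first_best
  let ?B = "{\<omega> \<in> Omega. snd \<omega> 1 = 1}"
  have inner: "(\<integral>\<^sup>+p. (\<integral>\<^sup>+U. indicator ?B (outcome_of (g, p) U) \<partial>arrivals) \<partial>pmf_of_set {p. p permutes {1..Suc g}})
      = ennreal (1 / real (Suc g))" for g
  proof -
    have "(\<integral>\<^sup>+p. (\<integral>\<^sup>+U. indicator ?B (outcome_of (g, p) U) \<partial>arrivals) \<partial>pmf_of_set {p. p permutes {1..Suc g}})
        = (\<integral>\<^sup>+p. indicator {p. p 1 = 1} p \<partial>pmf_of_set {p. p permutes {1..Suc g}})"
    proof (rule nn_integral_cong_AE, subst AE_measure_pmf_iff, safe)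
      fix p assume "p \<in> set_pmf (pmf_of_set {p. p permutes {1..Suc g}})"
      then have p: "p permutes {1..Suc g}"
        by (simp only: set_pmf_permutations mem_Collect_eq)
      have "(\<integral>\<^sup>+U. indicator ?B (outcome_of (g, p) U) \<partial>arrivals)
          = (\<integral>\<^sup>+U. indicator {p. p 1 = 1} p \<partial>arrivals)"
      proof (rule nn_integral_cong_AE)
        show "AE U in arrivals. indicator ?B (outcome_of (g, p) U) = (indicator {p. p 1 = 1} p :: ennreal)"
          using AE_outcome_of_ranks[OF p]
        proof eventually_elim
          case (elim U)
          then show ?case
            using outcome_of_in_Omega[of "(g, p)" U] by (simp add: indicator_def)
        qed
      qed
      then show "(\<integral>\<^sup>+U. indicator ?B (outcome_of (g, p) U) \<partial>arrivals) = indicator {p. p 1 = 1} p"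
        by (simp add: later_arrivals.emeasure_space_1[simplified])
    qed
    then show ?thesis
      using emeasure_first_fixed[of g] by simp
  qed
  have "emeasure law ?B = (\<integral>\<^sup>+\<omega>. indicator ?B \<omega> \<partial>law)"
    using sets_first_best by (subst nn_integral_indicator) (simp_all only: sets_law)
  also have "\<dots> = (\<integral>\<^sup>+g. ennreal (1 / real (Suc g)) \<partial>geometric_pmf a)"
    by (subst nn_integral_law) (simp_all only: inner, measurable)
  also have "\<dots> = (\<Sum>g. ennreal ((1 - a) ^ g * a / real (Suc g)))"
  proof -
    have "ennreal (pmf (geometric_pmf a) g) * ennreal (1 / real (Suc g))
        = ennreal ((1 - a) ^ g * a / real (Suc g))" for g
      using a_pos a_less_1 by (subst ennreal_mult[symmetric]) simp_all
    then show ?thesis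
      by (simp only: nn_integral_measure_pmf nn_integral_count_space_nat)
  qed
  finally have "(\<Sum>g<N. ennreal ((1 - a) ^ g * a / real (Suc g))) \<le> emeasure law ?B"
    using sum_le_suminf[of "\<lambda>g. ennreal ((1 - a) ^ g * a / real (Suc g))" "{..<N}"] by simp
  then have "ennreal (\<Sum>g<N. (1 - a) ^ g * a / real (Suc g)) \<le> ennreal (prob ?B)"
    using a_pos a_less_1 by (subst sum_ennreal[symmetric]) (auto simp: emeasure_eq_measure)
  then show ?thesis
    by (simp add: ennreal_le_iff)
qed

end

section \<open>Winning at a fixed time and winning with the 1/e-strategy\<close>

text \<open>The left limit is replaced by path values along a sequence that increases strictly to
  \<open>t\<close>, so that a jump becomes an event described by countably many coordinates.\<close>

lemma jump_eq_1_iff: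
  assumes n: "counting_path n" and t: "0 < t" "t \<le> 1"
  shows "jump n t = 1 \<longleftrightarrow> (\<forall>k. n (t * (1 - 1 / Suc k)) < n t)"
proof
  assume "jump n t = 1"
  moreover have "0 \<le> t * (1 - 1 / Suc k)" "t * (1 - 1 / Suc k) < t" for k
    using t by (auto simp: field_simps)
  ultimately show "\<forall>k. n (t * (1 - 1 / Suc k)) < n t"
    using counting_path_jump_greater[OF n] t by blast
next
  assume less: "\<forall>k. n (t * (1 - 1 / Suc k)) < n t"
  obtain d where d: "0 \<le> d" "d < t" "\<And>u. d \<le> u \<Longrightarrow> u < t \<Longrightarrow> n u = Lim (at_left t) n"
    using counting_path_left_limit[OF n t] by blast
  obtain k where "inverse (real (Suc k)) < (t - d) / t"
    using reals_Archimedean[of "(t - d) / t"] d t by auto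
  then have "d \<le> t * (1 - 1 / Suc k)" "t * (1 - 1 / Suc k) < t"
    using t by (auto simp: field_simps)
  then have "n (t * (1 - 1 / Suc k)) = Lim (at_left t) n"
    by (rule d(3))
  then have "Lim (at_left t) n < n t"
    using less by metis
  moreover have "jump n t \<in> {0, 1}"
    using n t by (auto simp: counting_path_def)
  ultimately show "jump n t = 1"
    using t by (auto simp: jump_def)
qed

lemma sets_rho_eq_1:
  assumes t: "0 < t" "t \<le> 1"
  shows "{\<omega> \<in> Omega. rho t \<omega> = 1} \<in> sets outcome_algebra"
proof -
  have "0 \<le> 1 - 1 / real (Suc k)" "1 - 1 / real (Suc k) \<le> 1" for k
    by simp_all
  then have "t * (1 - 1 / Suc k) \<in> {0..1}" for k
    using mult_nonneg_nonneg[of t] mult_le_one[of t] t by simp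
  note [measurable] = measurable_count_outcome_algebra[OF this] measurable_rank_outcome_algebra
  have [measurable]: "(\<lambda>\<omega>. fst \<omega> t) \<in> outcome_algebra \<rightarrow>\<^sub>M count_space UNIV"
    using t by (intro measurable_count_outcome_algebra) auto
  have [measurable]: "Measurable.pred outcome_algebra (\<lambda>\<omega>. snd \<omega> (fst \<omega> t) = 1)"
    by (rule measurable_compose_countable[where f = "\<lambda>k \<omega>. snd \<omega> k = 1"]) measurable
  have "{\<omega> \<in> space outcome_algebra. (\<forall>k. real (fst \<omega> (t * (1 - 1 / Suc k))) < real (fst \<omega> t))
      \<and> snd \<omega> (fst \<omega> t) = 1} \<in> sets outcome_algebra"
    by measurable
  also have "{\<omega> \<in> space outcome_algebra. (\<forall>k. real (fst \<omega> (t * (1 - 1 / Suc k))) < real (fst \<omega> t))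
      \<and> snd \<omega> (fst \<omega> t) = 1} = {\<omega> \<in> Omega. rho t \<omega> = 1}"
  proof (intro Collect_cong conj_cong)
    fix \<omega> assume "\<omega> \<in> Omega"
    then have "counting_path (fst \<omega>)" by (auto simp: Omega_def)
    from jump_eq_1_iff[OF this t]
    show "(\<forall>k. real (fst \<omega> (t * (1 - 1 / Suc k))) < real (fst \<omega> t)) \<and> snd \<omega> (fst \<omega> t) = 1
        \<longleftrightarrow> rho t \<omega> = 1"
      by (simp add: rho_def case_prod_beta)
  qed simp
  finally show ?thesis .
qed

lemma constant_strategy: "t \<in> {0..1} \<Longrightarrow> (\<lambda>_. t) \<in> strategies"
  by (simp add: strategies_def stopping_time_def)

text \<open>The strategy never stops before \<open>1 / exp 1\<close>, hence only after
  \<open>s\<close>, when a candidate has already arrived. A winning arrival then has index other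
  than 1, and rank 1 belongs to only one candidate.\<close>

lemma tau_star_not_first:
  assumes n: "counting_path n" and r: "r permutes {1..n 1}"
    and s: "0 \<le> s" "s < 1 / exp 1" "1 \<le> n s" and win: "rho (tau_star (n, r)) (n, r) = 1"
  shows "r 1 \<noteq> 1"
proof -
  define t where "t = tau_star (n, r)"
  have "1 / exp 1 \<le> (1 :: real)"
    by simp
  have t: "1 / exp 1 \<le> t" "t \<le> 1"
  proof -
    let ?S = "{t \<in> {1 / exp 1..1}. record_at t (n, r)}"
    have bdd: "bdd_below ?S"
      by (auto simp: bdd_below_def)
    have "1 / exp 1 \<le> Inf ?S \<and> Inf ?S \<le> 1" if ne: "?S \<noteq> {}"
    proof
      show "1 / exp 1 \<le> Inf ?S"
        using ne by (intro cInf_greatest) auto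
      obtain x where "x \<in> ?S" using ne by blast
      then have "Inf ?S \<le> x" "x \<le> 1"
        using bdd by (auto intro: cInf_lower)
      then show "Inf ?S \<le> 1" by simp
    qed
    then show "1 / exp 1 \<le> t" "t \<le> 1"
      using \<open>1 / exp 1 \<le> 1\<close> by (auto simp: t_def tau_star_def Let_def)
  qed
  have "jump n t = 1" "r (n t) = 1"
    using win by (auto simp: t_def rho_def split: if_splits)
  then have "n s < n t"
    using s t by (intro counting_path_jump_greater[OF n]) auto
  then have "n t \<noteq> 1"
    using s by simp
  then show ?thesis
    using permutes_inj[OF r] \<open>r (n t) = 1\<close> by (metis injD)
qed

section \<open>Comparison of the two strategies\<close>

context fixed_first_arrival
begin

text \<open>Almost surely the path jumps from 0 to 1 at \<open>a\<close>, so the candidate arriving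
  there is the one with index 1.\<close>

lemma win_prob_first_arrival: "win_prob law (\<lambda>_. a) = prob {\<omega> \<in> Omega. snd \<omega> 1 = 1}"
  unfolding win_prob_def
proof (rule finite_measure_eq_AE)
  show "AE \<omega> in law. \<omega> \<in> {\<omega> \<in> Omega. rho a \<omega> = 1} \<longleftrightarrow> \<omega> \<in> {\<omega> \<in> Omega. snd \<omega> 1 = 1}"
    using AE_law_first_arrival AE_space
  proof eventually_elim
    case (elim \<omega>)
    then have n: "counting_path (fst \<omega>)" by (auto simp: Omega_def)
    have "fst \<omega> u = 0" if "0 \<le> u" "u < a" for u
      using first_arrival_props(4)[OF n, of u] that elim by simp
    then have "Lim (at_left a) (fst \<omega>) = 0"
      using a_pos by (intro Lim_at_left_eqI[of 0]) auto
    then show ?case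
      using elim a_pos by (simp add: rho_def jump_def case_prod_beta)
  qed
qed (use a_pos a_less_1 sets_rho_eq_1 sets_first_best in auto)

lemma win_prob_tau_star_le:
  assumes "a < 1 / exp 1"
  shows "win_prob law tau_star \<le> 1 - prob {\<omega> \<in> Omega. snd \<omega> 1 = 1}"
proof -
  have [measurable]: "(\<lambda>\<omega>. fst \<omega> a) \<in> outcome_algebra \<rightarrow>\<^sub>M count_space UNIV"
    using a_pos a_less_1 by (intro measurable_count_outcome_algebra) auto
  let ?B = "{\<omega> \<in> Omega. snd \<omega> 1 = 1}"
  let ?Z = "{\<omega> \<in> space outcome_algebra. fst \<omega> a \<noteq> 1}"
  have B: "?B \<in> events"
    using sets_first_best by simp
  have "?Z \<in> sets outcome_algebra"
    by measurable
  then have Z: "?Z \<in> events"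
    by (simp only: sets_law)
  have "prob ?Z = 0"
    using AE_law_first_arrival by (intro measure_eq_0_null_sets AE_iff_null_sets[OF Z, THEN iffD2]) auto
  \<comment> \<open>The winning event lies in a measurable superset: the outcomes whose first
    candidate is not best, together with the null set where the count at \<open>a\<close> differs
    from 1.\<close>
  have "win_prob law tau_star \<le> prob ((space law - ?B) \<union> ?Z)"
    unfolding win_prob_def
  proof (rule finite_measure_mono)
    show "{\<omega> \<in> Omega. rho (tau_star \<omega>) \<omega> = 1} \<subseteq> (space law - ?B) \<union> ?Z"
    proof (rule subsetI, rule UnCI)
      fix \<omega> assume \<omega>: "\<omega> \<in> {\<omega> \<in> Omega. rho (tau_star \<omega>) \<omega> = 1}" and "\<omega> \<notin> ?Z"
      then have "fst \<omega> a = 1" by simp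
      with \<omega> show "\<omega> \<in> space law - ?B"
        using tau_star_not_first[of "fst \<omega>" "snd \<omega>" a] assms a_pos by (auto simp: Omega_def)
    qed
  qed (use B Z in blast)
  also have "\<dots> \<le> prob (space law - ?B) + prob ?Z"
    using sets.compl_sets[OF B] Z by (rule measure_Un_le)
  also have "\<dots> = 1 - prob ?B"
    using B \<open>prob ?Z = 0\<close> by (simp only: prob_compl)
  finally show ?thesis .
qed

end

theorem mainTheorem1:
  shows "\<not> (\<forall>P \<in> pi_laws. \<forall>\<tau> \<in> strategies. win_prob P tau_star \<ge> win_prob P \<tau>)"
proof -
  \<comment> \<open>The value must lie below \<open>1 / exp 1\<close> and yet be large enough for
    the first candidate to be best with probability above 1/2. The bound 2.72 for
    \<open>exp 1\<close> gives the former, three terms of the series the latter.\<close>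
  interpret fixed_first_arrival "9 / 25"
    by unfold_locales auto
  let ?b = "prob {\<omega> \<in> Omega. snd \<omega> 1 = 1}"
  have "exp 1 < (25 / 9 :: real)"
    using e_less_272 by simp
  then have "9 / 25 < 1 / exp (1 :: real)"
    by (simp add: field_simps)
  then have "win_prob law tau_star \<le> 1 - ?b"
    by (rule win_prob_tau_star_le)
  \<comment> \<open>The partial sum is 9/25 times (1 + 8/25 + 256/1875), about 0.524; two terms
    would stay below 1/2.\<close>
  moreover have "1 / 2 < ?b"
    using prob_first_best_ge[of 3] by (simp add: numeral_eq_Suc)
  ultimately have "win_prob law tau_star < win_prob law (\<lambda>_. 9 / 25)"
    by (simp add: win_prob_first_arrival)
  moreover have "(\<lambda>_. 9 / 25) \<in> strategies"
    by (rule constant_strategy) simp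
  ultimately show ?thesis
    using law_in_pi_laws by (metis not_le)
qed

end
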